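(* Let $X$ be a separable real Banach space. Then every convex body in $X$ can be approximated, with respect to the Hausdorff metric, by convex bodies that are both locally uniformly convex and Fréchet smooth (that is, for every convex body $B\subset X$ and every $\varepsilon>0$ there is a convex body $C\subset X$ that is both locally uniformly convex and Fréchet smooth with $d_H(B,C)<\varepsilon$) if and only if $X$ is an Asplund space.
   Context: A convex body in a real Banach space $X$ is a closed bounded convex set with nonempty interior. For convex bodies $A,B$, $d_H(A,B)=\inf\{r>0: A\subset \overline{B+rB_X},\ B\subset\overline{A+rB_X}\}$, where $B_X$ is the closed unit ball. For a closed convex set $C$ with $0\in\operatorname{int}C$, its Minkowski functional is $p_C(x)=\inf\{\lambda>0: x\in\lambda C\}$. A convex body $B$ with $0\in\operatorname{int}(B)$ is locally uniformly convex if for each $x\in\operatorname{bd}(B)$ and every sequence $\{x_n\}\subset\operatorname{bd}(B)$ with $p_B(x+x_n)\to 2$ one has $x_n\to x$; it is Fréchet smooth if $p_B$ is Fréchet differentiable at every nonzero point of $X$. A general convex body $B$ is locally uniformly convex (resp. Fréchet smooth) if there is $x_0\in\operatorname{int}(B)$ such that $B-x_0$ has the corresponding property. A Banach space $X$ is an Asplund space if every continuous convex function on $X$ is Fréchet differentiable at each point of a dense $G_\delta$ subset of $X$; equivalently, the dual of each separable subspace of $X$ is separable. *)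

theory Defs
  imports "HOL-Analysis.Analysis"
begin

definition convex_body :: "'a::real_normed_vector set \<Rightarrow> bool" where
  "convex_body B \<longleftrightarrow> closed B \<and> bounded B \<and> convex B \<and> interior B \<noteq> {}"

text \<open>
  For nonempty bounded sets, in particular for convex bodies, the set of radii below is nonempty
  (and bounded below by 0), so the infimum is the genuine one.
\<close>

definition hausdorff_dist :: "'a::real_normed_vector set \<Rightarrow> 'a set \<Rightarrow> real" where
  "hausdorff_dist A B = Inf {r. r > 0
     \<and> A \<subseteq> closure {b + r *\<^sub>R u | b u. b \<in> B \<and> u \<in> cball 0 1}
     \<and> B \<subseteq> closure {a + r *\<^sub>R u | a u. a \<in> A \<and> u \<in> cball 0 1}}"

text \<open>
  If 0 is an interior point of C, then the set of admissible scalars is nonempty for every x.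
\<close>

definition minkowski_functional :: "'a::real_normed_vector set \<Rightarrow> 'a \<Rightarrow> real" where
  "minkowski_functional C x = Inf {t. t > 0 \<and> x \<in> (\<lambda>y. t *\<^sub>R y) ` C}"

text \<open>
  The two predicates ending in \<open>_origin\<close> are meant for convex bodies having 0 as an interior
  point; the general notions below translate an interior point to the origin.
\<close>

definition locally_uniformly_convex_origin :: "'a::real_normed_vector set \<Rightarrow> bool" where
  "locally_uniformly_convex_origin B \<longleftrightarrow>
     (\<forall>x \<in> frontier B. \<forall>xs :: nat \<Rightarrow> 'a.
        (\<forall>n. xs n \<in> frontier B)
        \<longrightarrow> (\<lambda>n. minkowski_functional B (x + xs n)) \<longlonglongrightarrow> 2
        \<longrightarrow> xs \<longlonglongrightarrow> x)"

text \<open>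
  On a normed space, \<^term>\<open>f differentiable (at x)\<close> is Frechet differentiability, with a bounded
  linear derivative.
\<close>

definition frechet_smooth_origin :: "'a::real_normed_vector set \<Rightarrow> bool" where
  "frechet_smooth_origin B \<longleftrightarrow> (\<forall>x. x \<noteq> 0 \<longrightarrow> minkowski_functional B differentiable (at x))"

definition locally_uniformly_convex_body :: "'a::real_normed_vector set \<Rightarrow> bool" where
  "locally_uniformly_convex_body B \<longleftrightarrow>
     (\<exists>x0 \<in> interior B. locally_uniformly_convex_origin ((\<lambda>x. x - x0) ` B))"

definition frechet_smooth_body :: "'a::real_normed_vector set \<Rightarrow> bool" where
  "frechet_smooth_body B \<longleftrightarrow>
     (\<exists>x0 \<in> interior B. frechet_smooth_origin ((\<lambda>x. x - x0) ` B))"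

definition asplund_space :: "'a::banach itself \<Rightarrow> bool" where
  "asplund_space _ \<longleftrightarrow>
     (\<forall>f :: 'a \<Rightarrow> real. convex_on UNIV f \<longrightarrow> continuous_on UNIV f \<longrightarrow>
        (\<exists>D. gdelta D \<and> closure D = UNIV \<and> (\<forall>x \<in> D. f differentiable (at x))))"

end

theory Submission
  imports Defs "HOL-Complex_Analysis.Great_Picard"
begin

text \<open>
  If some body is Frechet smooth with gauge \<open>p\<close>, Ekeland's variational principle for the difference of
  \<open>K p(x - a)\<^sup>2\<close> and a continuous convex \<open>f\<close> yields points arbitrarily close to \<open>a\<close> at which \<open>f\<close> is
  almost differentiable; Baire's theorem does the rest.

  Conversely, let \<open>X\<close> be separable and Asplund. Then the dual is separable. In a separable normed
  space with dense sequence \<open>d\<close>, a weighted sum of the functions \<open>\<phi>(\<parallel>x - d n\<parallel>)\<close> with \<open>\<phi>\<close>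
  strictly convex and increasing is locally uniformly convex, because local uniform convexity only asks
  for convergence of the distances to every \<open>d n\<close>. On the dual this function is moreover weak-star
  lower semicontinuous, and adding a small multiple of it to the conjugate of a Lipschitz convex \<open>f\<close>
  and conjugating back gives a Frechet smooth approximation of \<open>f\<close>. A series of such smoothings of
  \<open>x \<mapsto> infdist x B\<close> plus a small locally uniformly convex function is both smooth and locally
  uniformly convex, and its sublevel sets are the required bodies. No Hahn-Banach theorem is needed:
  affine minorants are the derivatives at the densely many points of differentiability.
\<close>

section \<open>Ekeland variational principle and Frechet differentiability on dense sets\<close>

text \<open>Smoothness and local uniform convexity get in each other's way. Conjugation smooths a
  function but can spoil its strict convexity, and adding a locally uniformly convex function built
  from norms can spoil smoothness. Therefore the locally uniformly convex term is added before
  smoothing, and infinitely many smoothings with errors tending to 0 are averaged to recover it. The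
  work is done with Lipschitz convex functions instead of norms, because the bodies need not be
  symmetric. The Lipschitz constant confines the slopes to one ball of the dual; since the space is
  separable, sequences in this ball have pointwise convergent subsequences, and so the suprema are
  attained. Dense differentiability is used twice: for the separability of the dual, without which
  the locally uniformly convex function on the dual could not be built, and for affine minorants.
  The passage from functions to bodies rests on the gauge \<open>p\<close> of the set where
  \<open>G \<le> \<eta>\<close> being given implicitly by
  \<open>G (x / p x) = \<eta>\<close>.\<close>

lemma ekeland:
  fixes g :: "'a::complete_space \<Rightarrow> real"
  assumes S: "closed S" "a \<in> S" and cont: "continuous_on S g"
    and lower: "\<And>x. x \<in> S \<Longrightarrow> m \<le> g x" and "\<epsilon> > 0"
  obtains x where "x \<in> S" "g x \<le> g a" "\<And>y. y \<in> S \<Longrightarrow> g x - \<epsilon> * dist x y \<le> g y"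
proof -
  \<comment> \<open>\<open>T x\<close> collects the points below \<open>x\<close> in the order given
    by \<open>g y + \<epsilon> * dist x y \<le> g x\<close>. This order is transitive, so the sets
    \<open>T (X n)\<close> shrink along the sequence built below, and its limit lies in all of
    them.\<close>
  define T where "T x = {y \<in> S. g y + \<epsilon> * dist x y \<le> g x}" for x
  have step: "\<exists>y. y \<in> T x \<and> (\<forall>z\<in>T x. g y \<le> g z + (1/2)^n)" if "x \<in> S" for x and n :: nat
  proof -
    have ne: "g ` T x \<noteq> {}" using that by (auto simp: T_def)
    have bdd: "bdd_below (g ` T x)" by (rule bdd_belowI[of _ m]) (auto simp: T_def lower)
    have "Inf (g ` T x) < Inf (g ` T x) + (1/2)^n" by simp
    then obtain y where y: "y \<in> T x" "g y < Inf (g ` T x) + (1/2)^n"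
      using cInf_lessD[OF ne] by blast
    have "g y \<le> g z + (1/2)^n" if "z \<in> T x" for z
      using cInf_lower[OF _ bdd, of "g z"] that y by fastforce
    with y show ?thesis by blast
  qed
  have T_sub: "T x \<subseteq> S" for x by (auto simp: T_def)
  obtain X where X: "\<And>n. X n \<in> S" "X 0 = a" and XT: "\<And>n. X (Suc n) \<in> T (X n)"
    and Xinf: "\<And>n z. z \<in> T (X n) \<Longrightarrow> g (X (Suc n)) \<le> g z + (1/2)^n"
  proof -
    define P where "P n x \<longleftrightarrow> x \<in> S \<and> (n = 0 \<longrightarrow> x = a)" for n :: nat and x
    define Q where "Q n x y \<longleftrightarrow> y \<in> T x \<and> (\<forall>z\<in>T x. g y \<le> g z + (1/2)^n)" for n :: nat and x y
    obtain X where X: "\<forall>n. P n (X n) \<and> Q n (X n) (X (Suc n))"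
    proof (atomize_elim, rule dependent_nat_choice)
      show "\<exists>x. P 0 x" using S by (simp add: P_def)
      fix x n assume "P n x"
      then obtain y where "Q n x y" using step[of x n] unfolding P_def Q_def by blast
      moreover from this have "P (Suc n) y" using T_sub unfolding P_def Q_def by blast
      ultimately show "\<exists>y. P (Suc n) y \<and> Q n x y" by blast
    qed
    show ?thesis by (rule that[of X]) (use X in \<open>auto simp: P_def Q_def\<close>)
  qed
  have T_trans: "z \<in> T x" if "y \<in> T x" "z \<in> T y" for x y z
  proof -
    have "\<epsilon> * dist x z \<le> \<epsilon> * dist x y + \<epsilon> * dist y z"
      using mult_left_mono[OF dist_triangle[of x z y], of \<epsilon>] \<open>\<epsilon> > 0\<close> by (simp add: distrib_left)
    then show ?thesis using that by (auto simp: T_def)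
  qed
  have T_refl: "x \<in> T x" if "x \<in> S" for x using that by (simp add: T_def)
  have XT_le: "X n \<in> T (X k)" if "k \<le> n" for k n
    using that by (induction rule: dec_induct) (use X XT T_trans T_refl in blast)+
  have dec: "g (X n) \<le> g (X k)" "\<epsilon> * dist (X k) (X n) \<le> g (X k) - g (X n)" if "k \<le> n" for k n
    using XT_le[OF that] zero_le_dist[of "X k" "X n"] \<open>\<epsilon> > 0\<close>
    by (auto simp: T_def intro: order_trans[rotated])
  have "decseq (g \<circ> X)" using dec by (auto simp: decseq_def)
  then have "convergent (g \<circ> X)"
    using decseq_convergent[of "g \<circ> X" m] lower X by (metis comp_apply convergent_def)
  then have gC: "Cauchy (g \<circ> X)" by (rule convergent_Cauchy)
  \<comment> \<open>Distances along \<open>X\<close> are paid for by decreases of \<open>g\<close>,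
    and the values of \<open>g\<close> converge because they decrease and are bounded below.\<close>
  have "Cauchy X"
  proof (rule metric_CauchyI)
    fix e :: real assume "e > 0"
    then obtain M where M: "\<And>k n. k \<ge> M \<Longrightarrow> n \<ge> M \<Longrightarrow> dist (g (X k)) (g (X n)) < \<epsilon> * e"
      using metric_CauchyD[OF gC, of "\<epsilon> * e"] \<open>\<epsilon> > 0\<close> by auto
    have "dist (X k) (X n) < e" if "M \<le> k" "k \<le> n" for k n
    proof -
      have "\<epsilon> * dist (X k) (X n) < \<epsilon> * e"
        using dec(2)[OF that(2)] M[of k n] that by (simp add: dist_real_def)
      then show ?thesis using \<open>\<epsilon> > 0\<close> by simp
    qed
    then have "dist (X k) (X n) < e" if "M \<le> k" "M \<le> n" for k n
      using that \<open>\<And>n k. M \<le> k \<Longrightarrow> k \<le> n \<Longrightarrow> dist (X k) (X n) < e\<close> by (metis dist_commute nat_le_linear)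
    then show "\<exists>M. \<forall>k\<ge>M. \<forall>n\<ge>M. dist (X k) (X n) < e" by blast
  qed
  then obtain x where x: "X \<longlonglongrightarrow> x" by (auto simp: Cauchy_convergent_iff convergent_def)
  have xS: "x \<in> S" using closed_sequentially[OF S(1) _ x] X by blast
  have gx: "(\<lambda>n. g (X n)) \<longlonglongrightarrow> g x"
    by (rule continuous_on_tendsto_compose[OF cont x xS]) (use X in auto)
  have xT: "x \<in> T (X k)" for k
  proof -
    have "(\<lambda>n. g (X n) + \<epsilon> * dist (X k) (X n)) \<longlonglongrightarrow> g x + \<epsilon> * dist (X k) x"
      by (intro tendsto_intros gx x)
    then have "g x + \<epsilon> * dist (X k) x \<le> g (X k)"
      by (rule tendsto_upperbound) (use dec(2) in \<open>auto simp: eventually_sequentially algebra_simps\<close>)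
    then show ?thesis using xS by (simp add: T_def)
  qed
  show ?thesis
  proof
    show "x \<in> S" by fact
    show "g x \<le> g a"
      using xT[of 0, unfolded T_def X(2)] mult_nonneg_nonneg[OF less_imp_le[OF \<open>\<epsilon> > 0\<close>] zero_le_dist[of a x]]
      unfolding mem_Collect_eq by linarith
    fix y assume "y \<in> S"
    show "g x - \<epsilon> * dist x y \<le> g y"
    proof (rule ccontr)
      assume "\<not> g x - \<epsilon> * dist x y \<le> g y"
      \<comment> \<open>A violating \<open>y\<close> lies below \<open>x\<close>, hence in every
        \<open>T (X n)\<close>. Near minimality of \<open>X (Suc n)\<close> there forces
        \<open>g x \<le> g y\<close> in the limit, whereas the violation gives
        \<open>g y < g x\<close>.\<close>
      then have "y \<in> T x" using \<open>y \<in> S\<close> by (auto simp: T_def)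
      then have *: "g (X (Suc n)) \<le> g y + (1/2)^n" for n using Xinf T_trans xT by blast
      have "(\<lambda>n. g y + (1/2::real)^n) \<longlonglongrightarrow> g y + 0"
        by (intro tendsto_intros LIMSEQ_power_zero) auto
      then have "g x \<le> g y" 
        using LIMSEQ_le[OF LIMSEQ_Suc[OF gx]] * by auto
      moreover have "0 \<le> \<epsilon> * dist x y" using \<open>\<epsilon> > 0\<close> by simp
      ultimately show False using \<open>\<not> g x - \<epsilon> * dist x y \<le> g y\<close> by linarith
    qed
  qed
qed

text \<open>
  For convex functions the one-sided estimate implies the two-sided one by reflection in \<open>x\<close>.
\<close>

definition near_differentiable :: "('a::real_normed_vector \<Rightarrow> real) \<Rightarrow> real \<Rightarrow> 'a \<Rightarrow> bool" where
  "near_differentiable f e x \<longleftrightarrow>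
     (\<exists>l :: 'a \<Rightarrow>\<^sub>L real. \<exists>\<tau>>0. \<forall>h. norm h \<le> \<tau> \<longrightarrow> f (x + h) - f x - blinfun_apply l h \<le> e * norm h)"

lemma convex_on_midpoint:
  fixes f :: "'a::real_vector \<Rightarrow> real"
  assumes "convex_on UNIV f"
  shows "2 * f ((1/2) *\<^sub>R (x + y)) \<le> f x + f y"
  using convex_onD[OF assms, of "1/2" x y] by (simp add: scaleR_add_right)

lemma convex_on_reflect_bound:
  fixes f :: "'a::real_normed_vector \<Rightarrow> real" and l :: "'a \<Rightarrow>\<^sub>L real"
  assumes "convex_on UNIV f"
    and "\<And>h. norm h \<le> \<tau> \<Longrightarrow> f (x + h) - f x - blinfun_apply l h \<le> e * norm h"
    and "norm h \<le> \<tau>"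
  shows "\<bar>f (x + h) - f x - blinfun_apply l h\<bar> \<le> e * norm h"
  using convex_on_midpoint[OF assms(1), of "x + h" "x - h"] assms(2)[of h] assms(2)[of "- h"] assms(3)
  by (simp add: scaleR_2[symmetric] blinfun.minus_right)

text \<open>The slope \<open>l\<close> found at \<open>x\<close> also serves at
  \<open>x + k\<close>. On the sphere of radius \<open>\<tau> / 2\<close> about \<open>x + k\<close>
  the two errors at \<open>x\<close> add up to at most
  \<open>e * (3/4 * \<tau>) + e * (\<tau> / 4)\<close>, which is \<open>2 * e\<close> times that
  radius; convexity carries the bound from the sphere to all shorter vectors.\<close>

lemma near_differentiable_interior:
  fixes f :: "'a::real_normed_vector \<Rightarrow> real"
  assumes f: "convex_on UNIV f" and "near_differentiable f e x"
  shows "x \<in> interior {y. near_differentiable f (2 * e) y}"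
proof -
  obtain l :: "'a \<Rightarrow>\<^sub>L real" and \<tau> where "\<tau> > 0"
    and *: "\<And>h. norm h \<le> \<tau> \<Longrightarrow> f (x + h) - f x - blinfun_apply l h \<le> e * norm h"
    using assms(2) by (auto simp: near_differentiable_def)
  have abs: "\<bar>f (x + h) - f x - blinfun_apply l h\<bar> \<le> e * norm h" if "norm h \<le> \<tau>" for h
    using convex_on_reflect_bound[OF f *] that by blast
  have "near_differentiable f (2 * e) (x + k)" if k: "norm k < \<tau> / 4" for k
    unfolding near_differentiable_def
  proof (intro exI conjI allI impI)
    show "\<tau> / 2 > 0" using \<open>\<tau> > 0\<close> by simp
    fix h :: 'a assume h: "norm h \<le> \<tau> / 2"
    show "f (x + k + h) - f (x + k) - blinfun_apply l h \<le> 2 * e * norm h"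
    proof (cases "h = 0")
      case False
      define s where "s = norm h / (\<tau> / 2)"
      define u where "u = (1 / s) *\<^sub>R h"
      have s: "0 < s" "s \<le> 1" using h False \<open>\<tau> > 0\<close> by (auto simp: s_def field_simps)
      have hu: "h = s *\<^sub>R u" using s by (simp add: u_def)
      have nu: "norm u = \<tau> / 2" using False \<open>\<tau> > 0\<close> by (simp add: u_def s_def)
      have uk: "norm (u + k) \<le> 3/4 * \<tau>" using norm_triangle_ineq[of u k] nu k by linarith
      have e0: "0 \<le> e * norm u" using abs[of u] nu \<open>\<tau> > 0\<close> by linarith
      have e: "0 \<le> e" using e0 nu \<open>\<tau> > 0\<close> by (simp add: zero_le_mult_iff)
      have "f (x + (u + k)) - f x - blinfun_apply l (u + k) \<le> e * (3/4 * \<tau>)"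
        using abs[of "u + k"] uk \<open>\<tau> > 0\<close> mult_left_mono[OF uk e] by linarith
      moreover have "- (f (x + k) - f x - blinfun_apply l k) \<le> e * (\<tau> / 4)"
        using abs[of k] k \<open>\<tau> > 0\<close> mult_left_mono[OF less_imp_le[OF k] e] by linarith
      ultimately have 1: "f (x + k + u) - f (x + k) - blinfun_apply l u \<le> 2 * e * (\<tau> / 2)"
        by (simp add: blinfun.add_right algebra_simps)
      have "f (x + k + h) \<le> (1 - s) * f (x + k) + s * f (x + k + u)"
        using convex_onD[OF f, of s "x + k" "x + k + u"] s
        by (simp add: hu algebra_simps)
      then have "f (x + k + h) - f (x + k) - blinfun_apply l h \<le> s * (f (x + k + u) - f (x + k) - blinfun_apply l u)"
        by (simp add: hu blinfun.scaleR_right algebra_simps)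
      also have "\<dots> \<le> s * (2 * e * (\<tau> / 2))"
        using 1 s by (intro mult_left_mono) auto
      also have "\<dots> = 2 * e * norm h" using nu s by (simp add: hu)
      finally show ?thesis .
    qed simp
  qed
  then have "near_differentiable f (2 * e) y" if "y \<in> ball x (\<tau> / 4)" for y
    using that[unfolded mem_ball dist_norm] by (metis add_diff_cancel_left' diff_add_cancel add.commute norm_minus_commute)
  then show ?thesis
    using \<open>\<tau> > 0\<close> by (intro interiorI[of "ball x (\<tau> / 4)"]) auto
qed

text \<open>The slopes \<open>l n\<close> may differ. Comparing two of the estimates on the same
  short vectors bounds \<open>norm (l n - l k)\<close> by the sum of the two errors, so the slopes
  converge in the dual and their limit is the derivative.\<close>

lemma differentiable_if_near_differentiable:
  fixes f :: "'a::real_normed_vector \<Rightarrow> real"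
  assumes f: "convex_on UNIV f" and near: "\<And>n::nat. near_differentiable f (1 / Suc n) x"
  shows "f differentiable (at x)"
proof -
  have "\<forall>n. \<exists>l :: 'a \<Rightarrow>\<^sub>L real. \<exists>\<tau>>0. \<forall>h. norm h \<le> \<tau> \<longrightarrow> \<bar>f (x + h) - f x - blinfun_apply l h\<bar> \<le> 1 / real (Suc n) * norm h"
    using near convex_on_reflect_bound[OF f] unfolding near_differentiable_def by meson
  then obtain l :: "nat \<Rightarrow> 'a \<Rightarrow>\<^sub>L real" and \<tau> where \<tau>: "\<And>n. \<tau> n > 0"
    and l: "\<And>n h. norm h \<le> \<tau> n \<Longrightarrow> \<bar>f (x + h) - f x - blinfun_apply (l n) h\<bar> \<le> 1 / real (Suc n) * norm h"
    by metis
  have close: "norm (l n - l k) \<le> 1 / real (Suc n) + 1 / real (Suc k)" for n k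
  proof (rule norm_blinfun_bound)
    show "0 \<le> 1 / real (Suc n) + 1 / real (Suc k)" by simp
    fix h :: 'a
    show "norm (blinfun_apply (l n - l k) h) \<le> (1 / real (Suc n) + 1 / real (Suc k)) * norm h"
    proof (cases "h = 0")
      case False
      define t where "t = min (\<tau> n) (\<tau> k) / norm h"
      have t: "t > 0" "norm (t *\<^sub>R h) \<le> \<tau> n" "norm (t *\<^sub>R h) \<le> \<tau> k"
        using \<tau>[of n] \<tau>[of k] False by (auto simp: t_def min_def)
      have "\<bar>blinfun_apply (l n) (t *\<^sub>R h) - blinfun_apply (l k) (t *\<^sub>R h)\<bar> \<le> (1 / real (Suc n) + 1 / real (Suc k)) * norm (t *\<^sub>R h)"
        using l[OF t(2)] l[OF t(3)] by (simp add: distrib_right)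
      then have "t * \<bar>blinfun_apply (l n) h - blinfun_apply (l k) h\<bar> \<le> t * ((1 / real (Suc n) + 1 / real (Suc k)) * norm h)"
        using t(1) by (simp add: blinfun.scaleR_right abs_mult flip: right_diff_distrib)
      then show ?thesis using t(1) by (simp add: blinfun.diff_left)
    qed simp
  qed
  have "Cauchy l"
  proof (rule metric_CauchyI)
    fix e :: real assume "e > 0"
    then obtain N where N: "1 / real (Suc N) < e / 2" using nat_approx_posE half_gt_zero by metis
    have small: "1 / real (Suc n) < e / 2" if "N \<le> n" for n
      using that N by (smt (verit, best) Suc_le_mono frac_le of_nat_0_less_iff of_nat_mono zero_less_Suc)
    have "dist (l n) (l k) < e" if "N \<le> n" "N \<le> k" for n k
      using that close[of n k] small[of n] small[of k]
      unfolding dist_norm by linarith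
    then show "\<exists>M. \<forall>k\<ge>M. \<forall>n\<ge>M. dist (l k) (l n) < e" by blast
  qed
  then obtain L where L: "l \<longlonglongrightarrow> L" by (auto simp: Cauchy_convergent_iff convergent_def)
  have "(f has_derivative blinfun_apply L) (at x)"
    unfolding has_derivative_at_alt
  proof (intro conjI allI impI)
    show "bounded_linear (blinfun_apply L)" by (rule blinfun.bounded_linear_right)
    fix e :: real assume "e > 0"
    have "\<forall>\<^sub>F n in sequentially. dist (l n) L < e / 2"
      using tendstoD[OF L, of "e / 2"] \<open>e > 0\<close> by simp
    moreover have "\<forall>\<^sub>F n in sequentially. 1 / real (Suc n) < e / 2"
      using tendstoD[OF LIMSEQ_inverse_real_of_nat, of "e / 2"] \<open>e > 0\<close> by (simp add: inverse_eq_divide)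
    ultimately have "\<forall>\<^sub>F n in sequentially. dist (l n) L < e / 2 \<and> 1 / real (Suc n) < e / 2"
      by (rule eventually_conj)
    then obtain n where n: "dist (l n) L < e / 2" "1 / real (Suc n) < e / 2"
      by (auto simp: eventually_sequentially)
    show "\<exists>d>0. \<forall>y. norm (y - x) < d \<longrightarrow> norm (f y - f x - L (y - x)) \<le> e * norm (y - x)"
    proof (intro exI conjI allI impI)
      show "\<tau> n > 0" by fact
      fix y assume y: "norm (y - x) < \<tau> n"
      have "\<bar>f y - f x - l n (y - x)\<bar> \<le> e / 2 * norm (y - x)"
        using l[of "y - x" n] y mult_right_mono[OF less_imp_le[OF n(2)], of "norm (y - x)"]
        using norm_ge_zero[of "y - x"] unfolding add_diff_cancel_left' diff_add_cancel add.commute[of x] by linarith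
      moreover have "\<bar>l n (y - x) - L (y - x)\<bar> \<le> e / 2 * norm (y - x)"
        using norm_blinfun[of "l n - L" "y - x"] n(1)
          mult_right_mono[of "norm (l n - L)" "e / 2" "norm (y - x)"]
        by (simp add: blinfun.diff_left dist_norm)
      ultimately show "norm (f y - f x - L (y - x)) \<le> e * norm (y - x)" unfolding real_norm_def by linarith
    qed
  qed
  then show ?thesis by (auto simp: differentiable_def)
qed

text \<open>One point of near differentiability in each ball makes the sets \<open>U n\<close> open
  and dense, and their intersection is the dense G-delta set of differentiability given by Baire's
  theorem.\<close>

lemma asplund_spaceI:
  assumes "\<And>f e a \<rho>. convex_on UNIV f \<Longrightarrow> continuous_on UNIV f \<Longrightarrow> e > 0 \<Longrightarrow> \<rho> > 0 \<Longrightarrow>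
    \<exists>x \<in> ball a \<rho>. near_differentiable f e (x :: 'a::banach)"
  shows "asplund_space TYPE('a)"
  unfolding asplund_space_def
proof (intro allI impI)
  fix f :: "'a \<Rightarrow> real" assume f: "convex_on UNIV f" "continuous_on UNIV f"
  define U where "U n = interior {y. near_differentiable f (1 / real (Suc n)) y}" for n
  have dense: "closure (U n) = UNIV" for n
  proof -
    have "\<exists>y\<in>U n. dist y a < \<rho>" if \<rho>: "\<rho> > 0" for a \<rho>
    proof -
      \<comment> \<open>Half of the target error, since passing to the interior doubles it.\<close>
      have "0 < 1 / (2 * real (Suc n))" by simp
      from assms[OF f this \<rho>, of a] obtain x where x: "x \<in> ball a \<rho>"
        "near_differentiable f (1 / (2 * real (Suc n))) x" by blast
      have "2 * (1 / (2 * real (Suc n))) = 1 / real (Suc n)" by (simp add: field_simps)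
      with near_differentiable_interior[OF f(1) x(2)] have "x \<in> U n" unfolding U_def by metis
      with x(1) show ?thesis by (auto simp: dist_commute)
    qed
    then show ?thesis by (auto simp: closure_approachable)
  qed
  have "gdelta (\<Inter>(range U))" by (intro gdelta.intros) (simp add: U_def)
  moreover have "closure (\<Inter>(range U)) = UNIV"
    using Met_TC.metric_Baire_category[of "range U"] dense
    by (auto simp: complete_UNIV U_def)
  moreover have "f differentiable (at x)" if "x \<in> \<Inter>(range U)" for x
  proof (rule differentiable_if_near_differentiable[OF f(1)])
    fix n show "near_differentiable f (1 / Suc n) x"
      using that interior_subset[of "{y. near_differentiable f (1 / real (Suc n)) y}"]
      by (fastforce simp: U_def)
  qed
  ultimately show "\<exists>D. gdelta D \<and> closure D = UNIV \<and> (\<forall>x\<in>D. f differentiable at x)" by blast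
qed

section \<open>Smooth gauges force the Asplund property\<close>

lemma asplund_if_smooth_gauge:
  fixes p :: "'a::banach \<Rightarrow> real"
  assumes smooth: "\<And>x. x \<noteq> 0 \<Longrightarrow> p differentiable (at x)"
    and bounds: "\<And>x. norm x \<le> c * p x" "\<And>x. \<bar>p x\<bar> \<le> C * norm x"
    and "c > 0" "C > 0"
  shows "asplund_space TYPE('a)"
proof (rule asplund_spaceI)
  fix f :: "'a \<Rightarrow> real" and e \<rho> :: real and a :: 'a
  assume f: "convex_on UNIV f" "continuous_on UNIV f" and "e > 0" "\<rho> > 0"
  have p0: "p 0 = 0" using bounds(2)[of 0] by simp
  \<comment> \<open>Nothing is assumed of \<open>p\<close> at 0, which corresponds to the centre
    \<open>a\<close> below. The square is differentiable there with derivative 0, being bounded by a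
    multiple of the squared norm.\<close>
  define q where "q x = (p x)\<^sup>2" for x
  have q_diff: "q differentiable (at x)" for x
  proof (cases "x = 0")
    case False
    have "(\<lambda>x. p x ^ 2) differentiable (at x)"
      by (rule differentiable_power) (rule smooth[OF False])
    then show ?thesis by (simp add: q_def[abs_def])
  next
    case True
    have "(q has_derivative (\<lambda>h. 0)) (at 0)"
      unfolding has_derivative_at_alt
    proof (intro conjI allI impI)
      fix d :: real assume "d > 0"
      have "norm (q y - q 0 - 0) \<le> d * norm (y - 0)" if "norm (y - 0) < d / C\<^sup>2" for y
      proof -
        have "q y \<le> (C * norm y)\<^sup>2"
          unfolding q_def using bounds(2)[of y] by (metis abs_ge_zero power2_abs power_mono)
        also have "\<dots> = C\<^sup>2 * norm y * norm y" by (simp add: power2_eq_square)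
        also have "\<dots> \<le> d * norm y"
          using that \<open>C > 0\<close> by (intro mult_right_mono) (auto simp: field_simps)
        finally show ?thesis by (simp add: q_def p0)
      qed
      moreover have "d / C\<^sup>2 > 0" using \<open>d > 0\<close> \<open>C > 0\<close> by simp
      ultimately show "\<exists>d'>0. \<forall>y. norm (y - 0) < d' \<longrightarrow> norm (q y - q 0 - 0) \<le> d * norm (y - 0)"
        by blast
    qed simp
    then show ?thesis using True by (auto simp: differentiable_def)
  qed
  have "isCont f a" using f(2) by (simp add: continuous_on_eq_continuous_at)
  then obtain d where d: "d > 0" "\<And>y. dist y a < d \<Longrightarrow> dist (f y) (f a) < 1"
    by (metis continuous_at_eps_delta zero_less_one)
  define r where "r = min d \<rho> / 2"
  have r: "r > 0" "r < d" "r < \<rho>" using d \<open>\<rho> > 0\<close> by (auto simp: r_def)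
  \<comment> \<open>This makes \<open>\<psi>\<close> at least 2 on the sphere of radius
    \<open>r\<close> about \<open>a\<close>, while \<open>f\<close> changes by less than 1 on the
    ball. The Ekeland point has a value not above that of \<open>a\<close>, so it lies in the open
    ball and leaves room for small \<open>h\<close>.\<close>
  define K where "K = 2 * c\<^sup>2 / r\<^sup>2"
  have "K > 0" using r \<open>c > 0\<close> by (simp add: K_def)
  define \<psi> where "\<psi> x = K * q (x - a)" for x
  have \<psi>_diff: "\<psi> differentiable (at x)" for x
  proof -
    have "(q \<circ> (\<lambda>x. x - a)) differentiable (at x)"
      by (intro differentiable_chain_at q_diff) auto
    then show ?thesis
      unfolding \<psi>_def[abs_def] o_def by (intro differentiable_mult differentiable_const)
  qed
  have \<psi>0: "\<psi> x \<ge> 0" for x using \<open>K > 0\<close> by (simp add: \<psi>_def q_def)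
  have fa: "\<bar>f y - f a\<bar> < 1" if "y \<in> cball a r" for y
    using d(2)[of y] that r by (auto simp: dist_real_def dist_commute)
  have cont: "continuous_on (cball a r) (\<lambda>x. \<psi> x - f x)"
    using \<psi>_diff f(2)
    by (intro continuous_intros continuous_at_imp_continuous_on)
       (auto simp: differentiable_imp_continuous_within continuous_on_eq_continuous_at)
  obtain x where x: "x \<in> cball a r" "\<psi> x - f x \<le> \<psi> a - f a"
    and xmin: "\<And>y. y \<in> cball a r \<Longrightarrow> \<psi> x - f x - e / 2 * dist x y \<le> \<psi> y - f y"
  proof (rule ekeland[OF closed_cball _ cont])
    show "a \<in> cball a r" "e / 2 > 0" using r \<open>e > 0\<close> by auto
    show "- f a - 1 \<le> \<psi> x - f x" if "x \<in> cball a r" for x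
      using fa[OF that] \<psi>0[of x] by linarith
  qed blast
  have "dist a x < r"
  proof (rule ccontr)
    assume "\<not> ?thesis"
    then have nx: "norm (x - a) = r" using x by (simp add: dist_norm norm_minus_commute)
    have "r\<^sup>2 \<le> (c * p (x - a))\<^sup>2"
      using bounds(1)[of "x - a"] nx r by (intro power_mono) auto
    then have "2 \<le> \<psi> x"
      using r \<open>c > 0\<close> by (simp add: \<psi>_def K_def q_def field_simps power_mult_distrib)
    moreover have "\<psi> a = 0" by (simp add: \<psi>_def q_def p0)
    ultimately show False using x(2) fa[OF x(1)] by linarith
  qed
  obtain \<psi>' where "(\<psi> has_derivative \<psi>') (at x)" using \<psi>_diff by (auto simp: differentiable_def)
  then obtain t where bl: "bounded_linear \<psi>'" and "t > 0" and
    t: "\<And>y. norm (y - x) < t \<Longrightarrow> norm (\<psi> y - \<psi> x - \<psi>' (y - x)) \<le> e / 2 * norm (y - x)"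
    unfolding has_derivative_at_alt using \<open>e > 0\<close> half_gt_zero by metis
  have "near_differentiable f e x"
    unfolding near_differentiable_def
  proof (intro exI conjI allI impI)
    show "min (t / 2) (r - dist a x) > 0" using \<open>t > 0\<close> \<open>dist a x < r\<close> by simp
    fix h :: 'a assume h: "norm h \<le> min (t / 2) (r - dist a x)"
    have "x + h \<in> cball a r"
      using h dist_triangle[of a "x + h" x] by (simp add: dist_norm)
    \<comment> \<open>Near minimality of \<open>\<psi> - f\<close> turns the first-order upper
      estimate of \<open>\<psi>\<close> into one of \<open>f\<close>; the two errors of
      \<open>e / 2\<close> add up to \<open>e\<close>.\<close>
    from xmin[OF this] have "f (x + h) - f x \<le> \<psi> (x + h) - \<psi> x + e / 2 * norm h"
      by (simp add: dist_norm)
    moreover have "\<bar>\<psi> (x + h) - \<psi> x - \<psi>' h\<bar> \<le> e / 2 * norm h"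
      using t[of "x + h"] h \<open>t > 0\<close> by simp
    ultimately show "f (x + h) - f x - blinfun_apply (Blinfun \<psi>') h \<le> e * norm h"
      using abs_le_D1 by (fastforce simp: bounded_linear_Blinfun_apply[OF bl])
  qed
  moreover have "x \<in> ball a \<rho>" using \<open>dist a x < r\<close> r by simp
  ultimately show "\<exists>x\<in>ball a \<rho>. near_differentiable f e x" by blast
qed

section \<open>Separability of the dual\<close>

lemma asplund_dense_derivative:
  fixes f :: "'a::banach \<Rightarrow> real"
  assumes "asplund_space TYPE('a)" "convex_on UNIV f" "continuous_on UNIV f" "\<rho> > 0"
  obtains x and l :: "'a \<Rightarrow>\<^sub>L real" where "dist x a < \<rho>" "(f has_derivative blinfun_apply l) (at x)"
proof -
  obtain D where D: "closure D = UNIV" "\<And>x. x \<in> D \<Longrightarrow> f differentiable (at x)"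
    using assms(1)[unfolded asplund_space_def, rule_format, OF assms(2,3)] by blast
  have "a \<in> closure D" using D by simp
  then obtain x where x: "x \<in> D" "dist x a < \<rho>" using \<open>\<rho> > 0\<close> by (auto simp: closure_approachable)
  obtain f' where f': "(f has_derivative f') (at x)" using D(2)[OF x(1)] by (auto simp: differentiable_def)
  then have "blinfun_apply (Blinfun f') = f'"
    by (intro bounded_linear_Blinfun_apply) (rule has_derivative_bounded_linear)
  then show ?thesis using that[of x "Blinfun f'"] x f' by simp
qed

section \<open>Subgradients and suprema of affine functions\<close>

lemma convex_on_subgradient:
  fixes f :: "'a::real_normed_vector \<Rightarrow> real"
  assumes f: "convex_on UNIV f" and l: "(f has_derivative l) (at x)"
  shows "f x + l (y - x) \<le> f y"
proof (rule field_le_epsilon)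
  fix e :: real assume "e > 0"
  define v where "v = y - x"
  define e' where "e' = e / (norm v + 1)"
  have "e' > 0" using \<open>e > 0\<close> by (simp add: e'_def add_nonneg_pos)
  then obtain d where "d > 0"
    and d: "\<And>z. norm (z - x) < d \<Longrightarrow> norm (f z - f x - l (z - x)) \<le> e' * norm (z - x)"
    using l unfolding has_derivative_at_alt by (elim conjE allE[of _ e']) auto
  \<comment> \<open>Chosen so that \<open>x + t v\<close> lies where the first-order estimate holds;
    \<open>norm v + 1\<close> also covers \<open>v = 0\<close>. The error is then at most
    \<open>e' * (t * norm v)\<close>, and dividing by \<open>t\<close> leaves at most
    \<open>e\<close>.\<close>
  define t where "t = min 1 (d / (2 * (norm v + 1)))"
  have t: "0 < t" "t \<le> 1" using \<open>d > 0\<close> by (auto simp: t_def add_nonneg_pos)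
  have "t * norm v \<le> d / (2 * (norm v + 1)) * norm v"
    by (intro mult_right_mono) (auto simp: t_def)
  also have "\<dots> \<le> d / (2 * (norm v + 1)) * (norm v + 1)" using \<open>d > 0\<close> by (intro mult_left_mono) auto
  also have "\<dots> = d / 2"
  proof -
    have "norm v + 1 \<noteq> 0" using norm_ge_zero[of v] by linarith
    then show ?thesis by (simp add: nonzero_divide_eq_eq mult.commute)
  qed
  finally have "norm (t *\<^sub>R v) < d" using t \<open>d > 0\<close> by auto
  then have "\<bar>f (x + t *\<^sub>R v) - f x - l (t *\<^sub>R v)\<bar> \<le> e' * norm (t *\<^sub>R v)" using d[of "x + t *\<^sub>R v"] by simp
  moreover have "f (x + t *\<^sub>R v) \<le> (1 - t) * f x + t * f y"
    using convex_onD[OF f, of t x y] t by (simp add: v_def algebra_simps)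
  moreover have "l (t *\<^sub>R v) = t * l v"
    using has_derivative_bounded_linear[OF l] by (simp add: linear_cmul bounded_linear.linear)
  moreover have "norm (t *\<^sub>R v) = t * norm v" using t by simp
  ultimately have "t * l v \<le> t * f y - t * f x + e' * (t * norm v)" unfolding left_diff_distrib by auto
  then have "t * l v \<le> t * (f y - f x + e' * norm v)" by (simp add: algebra_simps)
  then have "l v \<le> f y - f x + e' * norm v" using t by simp
  also have "e' * norm v \<le> e' * (norm v + 1)" using \<open>e' > 0\<close> by simp
  also have "e' * (norm v + 1) = e" by (simp add: e'_def add_nonneg_eq_0_iff)
  finally show "f x + l (y - x) \<le> f y + e" by (simp add: v_def)
qed

text \<open>Serves two families: a bounded set of functionals with \<open>c = 0\<close>, whose
  supremum is its support function, and the lowered affine minorants whose supremum is the smoothed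
  function.\<close>

lemma convex_on_SUP_affine:
  fixes s :: "'i \<Rightarrow> 'a::real_normed_vector \<Rightarrow>\<^sub>L real"
  assumes "I \<noteq> {}" and bdd: "\<And>x. bdd_above ((\<lambda>i. s i x + c i) ` I)"
  shows "convex_on UNIV (\<lambda>x. SUP i\<in>I. s i x + c i)"
proof
  fix t :: real and x y :: 'a assume t: "0 < t" "t < 1"
  show "(SUP i\<in>I. s i ((1 - t) *\<^sub>R x + t *\<^sub>R y) + c i)
    \<le> (1 - t) * (SUP i\<in>I. s i x + c i) + t * (SUP i\<in>I. s i y + c i)"
  proof (rule cSUP_least[OF \<open>I \<noteq> {}\<close>])
    fix i assume i: "i \<in> I"
    have "s i ((1 - t) *\<^sub>R x + t *\<^sub>R y) + c i = (1 - t) * (s i x + c i) + t * (s i y + c i)"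
      by (simp add: blinfun.add_right blinfun.scaleR_right distrib_left) (simp add: algebra_simps)
    also have "\<dots> \<le> (1 - t) * (SUP i\<in>I. s i x + c i) + t * (SUP i\<in>I. s i y + c i)"
      using t by (intro add_mono mult_left_mono cSUP_upper[OF i bdd]) auto
    finally show "s i ((1 - t) *\<^sub>R x + t *\<^sub>R y) + c i
      \<le> (1 - t) * (SUP i\<in>I. s i x + c i) + t * (SUP i\<in>I. s i y + c i)" .
  qed
qed simp

lemma lipschitz_on_SUP_affine:
  fixes s :: "'i \<Rightarrow> 'a::real_normed_vector \<Rightarrow>\<^sub>L real"
  assumes "I \<noteq> {}" and bdd: "\<And>x. bdd_above ((\<lambda>i. s i x + c i) ` I)"
    and L: "\<And>i. i \<in> I \<Longrightarrow> norm (s i) \<le> L"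
  shows "L-lipschitz_on UNIV (\<lambda>x. SUP i\<in>I. s i x + c i)"
proof (rule lipschitz_onI)
  obtain i where "i \<in> I" using \<open>I \<noteq> {}\<close> by blast
  then show "0 \<le> L" using L norm_ge_zero order_trans by blast
  have *: "(SUP i\<in>I. s i x + c i) \<le> (SUP i\<in>I. s i y + c i) + L * norm (x - y)" for x y
  proof (rule cSUP_least[OF \<open>I \<noteq> {}\<close>])
    fix i assume i: "i \<in> I"
    have "s i (x - y) \<le> norm (s i) * norm (x - y)" using norm_blinfun[of "s i" "x - y"] by simp
    also have "\<dots> \<le> L * norm (x - y)" by (intro mult_right_mono L i) auto
    finally have "s i x + c i \<le> s i y + c i + L * norm (x - y)" by (simp add: blinfun.diff_right)
    also have "s i y + c i \<le> (SUP i\<in>I. s i y + c i)" by (rule cSUP_upper[OF i bdd])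
    finally show "s i x + c i \<le> (SUP i\<in>I. s i y + c i) + L * norm (x - y)" by simp
  qed
  show "dist (SUP i\<in>I. s i x + c i) (SUP i\<in>I. s i y + c i) \<le> L * dist x y" for x y
    using *[of x y] *[of y x] unfolding dist_norm real_norm_def norm_minus_commute[of y] by linarith
qed

text \<open>
  The sets that are covered by countably many sets of diameter at most \<open>e\<close> form a sigma-ideal. Remove
  from the ball all slices in this ideal (countably many suffice). If the rest \<open>A\<close> were nonempty, a point
  of differentiability of its support function would provide a slice of \<open>A\<close> of small diameter.
\<close>

lemma asplund_dual_ball_cover:
  fixes D :: "'a::banach set" and N e :: real
  assumes asplund: "asplund_space TYPE('a)" and D: "countable D" "closure D = UNIV"
    and "N \<ge> 0" "e > 0"
  shows "\<exists>\<U>. countable \<U> \<and> cball (0 :: 'a \<Rightarrow>\<^sub>L real) N \<subseteq> \<Union>\<U> \<and> (\<forall>V\<in>\<U>. \<forall>a\<in>V. \<forall>b\<in>V. dist a b \<le> e)"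
proof -
  define small where "small U \<longleftrightarrow>
    (\<exists>\<U>. countable \<U> \<and> U \<subseteq> \<Union>\<U> \<and> (\<forall>V\<in>\<U>. \<forall>a\<in>V. \<forall>b\<in>V. dist a b \<le> e))" for U :: "('a \<Rightarrow>\<^sub>L real) set"
  have small_mono: "small U" if V: "small V" "U \<subseteq> V" for U V
  proof -
    obtain \<U> where "countable \<U> \<and> V \<subseteq> \<Union>\<U> \<and> (\<forall>V\<in>\<U>. \<forall>a\<in>V. \<forall>b\<in>V. dist a b \<le> e)"
      using V(1) unfolding small_def ..
    with V(2) show ?thesis unfolding small_def by (intro exI[of _ \<U>]) auto
  qed
  have small_Union: "small (\<Union>\<A>)" if "countable \<A>" "\<And>U. U \<in> \<A> \<Longrightarrow> small U" for \<A>
  proof -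
    have "\<forall>U\<in>\<A>. \<exists>\<U>. countable \<U> \<and> U \<subseteq> \<Union>\<U> \<and> (\<forall>V\<in>\<U>. \<forall>a\<in>V. \<forall>b\<in>V. dist a b \<le> e)"
      using that(2) by (auto simp: small_def)
    then obtain F where F: "\<And>U. U \<in> \<A> \<Longrightarrow> countable (F U) \<and> U \<subseteq> \<Union>(F U) \<and> (\<forall>V\<in>F U. \<forall>a\<in>V. \<forall>b\<in>V. dist a b \<le> e)"
      by metis
    show ?thesis
      unfolding small_def
    proof (intro exI[of _ "\<Union>(F ` \<A>)"] conjI)
      show "countable (\<Union>(F ` \<A>))" using F that(1) by (intro countable_UN) auto
      have "U \<subseteq> \<Union>(\<Union>(F ` \<A>))" if "U \<in> \<A>" for U
        using F[OF that] Union_mono[OF UN_upper[OF that, of F]] by (elim conjE) (rule subset_trans)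
      then show "\<Union>\<A> \<subseteq> \<Union>(\<Union>(F ` \<A>))" by (rule Union_least)
      show "\<forall>V\<in>\<Union>(F ` \<A>). \<forall>a\<in>V. \<forall>b\<in>V. dist a b \<le> e"
      proof
        fix V assume "V \<in> \<Union>(F ` \<A>)"
        then obtain U where "U \<in> \<A>" "V \<in> F U" by (rule UN_E)
        then show "\<forall>a\<in>V. \<forall>b\<in>V. dist a b \<le> e" using F[of U] by simp
      qed
    qed
  qed
  have small_diam: "small U" if "\<And>a b. a \<in> U \<Longrightarrow> b \<in> U \<Longrightarrow> dist a b \<le> e" for U
    unfolding small_def using that by (intro exI[of _ "{U}"]) auto
  \<comment> \<open>\<open>sl (y, t)\<close> is the slice of the ball where \<open>s y > t\<close>.
    With \<open>y\<close> in \<open>D\<close> and \<open>t\<close> rational there are countably many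
    slices, so \<open>A0\<close> is still small.\<close>
  define sl where "sl z = {s \<in> cball 0 N. blinfun_apply s (fst z) > snd z}" for z :: "'a \<times> real"
  define A0 where "A0 = \<Union>{sl z | z. z \<in> D \<times> \<rat> \<and> small (sl z)}"
  have "small A0" unfolding A0_def
  proof (rule small_Union)
    have "countable (sl ` {z \<in> D \<times> \<rat>. small (sl z)})"
      using D(1) countable_rat by (intro countable_image countable_subset[OF _ countable_SIGMA[of D "\<lambda>_. \<rat>"]]) auto
    then show "countable {sl z |z. z \<in> D \<times> \<rat> \<and> small (sl z)}" unfolding setcompr_eq_image .
  qed auto
  define A where "A = cball 0 N - A0"
  have "A = {}"
  proof (rule ccontr)
    assume "A \<noteq> {}"
    have A_norm: "norm s \<le> N" if "s \<in> A" for s using that by (auto simp: A_def)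
    have bdd: "bdd_above ((\<lambda>s. blinfun_apply s x + 0) ` A)" for x
    proof (rule bdd_aboveI2)
      fix s assume "s \<in> A"
      have "blinfun_apply s x \<le> norm s * norm x" using norm_blinfun[of s x] by simp
      also have "\<dots> \<le> N * norm x" using A_norm[OF \<open>s \<in> A\<close>] by (intro mult_right_mono) auto
      finally show "blinfun_apply s x + 0 \<le> N * norm x" by simp
    qed
    define f where "f x = (SUP s\<in>A. blinfun_apply s x + 0)" for x
    have f: "convex_on UNIV f" "N-lipschitz_on UNIV f"
      unfolding f_def[abs_def]
      using convex_on_SUP_affine[OF \<open>A \<noteq> {}\<close> bdd] lipschitz_on_SUP_affine[OF \<open>A \<noteq> {}\<close> bdd A_norm] by auto
    have f_ge: "blinfun_apply s x \<le> f x" if "s \<in> A" for s x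
      using cSUP_upper[OF that bdd[of x]] by (simp add: f_def)
    obtain x and l :: "'a \<Rightarrow>\<^sub>L real" where "(f has_derivative blinfun_apply l) (at x)"
      using asplund_dense_derivative[OF asplund f(1) lipschitz_on_continuous_on[OF f(2)] zero_less_one] by metis
    then obtain d where "d > 0" and
      d: "\<And>y. norm (y - x) < d \<Longrightarrow> norm (f y - f x - blinfun_apply l (y - x)) \<le> e / 8 * norm (y - x)"
      using \<open>e > 0\<close> unfolding has_derivative_at_alt by (elim conjE allE[of _ "e / 8"]) auto
    define r where "r = d / 2"
    have r: "r > 0" "r < d" using \<open>d > 0\<close> by (auto simp: r_def)
    \<comment> \<open>For \<open>s\<close> in \<open>A\<close> with
      \<open>s x > f x - \<delta>\<close>, comparison with \<open>f\<close> on the sphere of radius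
      \<open>r\<close> about \<open>x\<close> bounds \<open>s - l\<close> there by
      \<open>\<delta>\<close> plus the differentiability error \<open>e / 8 * r\<close>, together
      \<open>e / 4 * r\<close>.\<close>
    define \<delta> where "\<delta> = e / 8 * r"
    have "\<delta> > 0" using \<open>e > 0\<close> r by (simp add: \<delta>_def)
    have close: "norm (s - l) \<le> e / 4" if s: "s \<in> A" "blinfun_apply s x > f x - \<delta>" for s
    proof (rule norm_blinfun_bound)
      show "0 \<le> e / 4" using \<open>e > 0\<close> by simp
      fix h :: 'a
      show "norm (blinfun_apply (s - l) h) \<le> e / 4 * norm h"
      proof (cases "h = 0")
        case False
        define k where "k = (r / norm h) *\<^sub>R h"
        have k: "norm k = r" using False r by (simp add: k_def)
        have *: "blinfun_apply (s - l) v \<le> e / 4 * r" if "norm v = r" for v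
        proof -
          have "blinfun_apply s x + blinfun_apply s v \<le> f (x + v)" using f_ge[OF s(1), of "x + v"] by (simp add: blinfun.add_right)
          moreover have "\<bar>f (x + v) - f x - blinfun_apply l v\<bar> \<le> e / 8 * r" using d[of "x + v"] that r by simp
          moreover have "\<delta> + e / 8 * r = e / 4 * r" by (simp add: \<delta>_def)
          ultimately show ?thesis using s(2) unfolding blinfun.diff_left by linarith
        qed
        have "\<bar>blinfun_apply (s - l) k\<bar> \<le> e / 4 * r"
          using *[of k] *[of "- k"] k by (simp add: blinfun.minus_right abs_le_iff)
        also have "blinfun_apply (s - l) k = r / norm h * blinfun_apply (s - l) h"
          by (simp add: k_def blinfun.scaleR_right)
        finally show ?thesis using False r by (simp add: abs_mult field_simps)
      qed simp
    qed
    define \<eta> where "\<eta> = \<delta> / (4 * (N + 1))"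
    have "\<eta> > 0" using \<open>\<delta> > 0\<close> \<open>N \<ge> 0\<close> by (simp add: \<eta>_def)
    have N\<eta>: "N * \<eta> \<le> \<delta> / 4" using \<open>\<delta> > 0\<close> \<open>N \<ge> 0\<close> by (simp add: \<eta>_def divide_simps)
    have "x \<in> closure D" using D by simp
    then obtain z where z: "z \<in> D" "dist z x < \<eta>" using \<open>\<eta> > 0\<close> by (auto simp: closure_approachable)
    have near: "\<bar>blinfun_apply s z - blinfun_apply s x\<bar> \<le> \<delta> / 4" if "norm s \<le> N" for s :: "'a \<Rightarrow>\<^sub>L real"
    proof -
      have "\<bar>blinfun_apply s (z - x)\<bar> \<le> norm s * norm (z - x)" using norm_blinfun[of s "z - x"] by simp
      also have "\<dots> \<le> N * \<eta>" using that z \<open>N \<ge> 0\<close> by (intro mult_mono) (auto simp: dist_norm)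
      finally show ?thesis using N\<eta> by (simp add: blinfun.diff_right)
    qed
    have "f x - \<delta> / 4 < (SUP s\<in>A. blinfun_apply s x + 0)" using \<open>\<delta> > 0\<close> by (simp add: f_def)
    then have "\<exists>s\<in>A. f x - \<delta> / 4 < blinfun_apply s x + 0"
      using less_cSUP_iff[OF \<open>A \<noteq> {}\<close> bdd[of x]] by blast
    then obtain s0 where s0: "s0 \<in> A" "blinfun_apply s0 x > f x - \<delta> / 4" by auto
    \<comment> \<open>Replacing \<open>x\<close> by \<open>z\<close> moves values by at most
      \<open>\<delta> / 4\<close>. The upper limit for \<open>t\<close> keeps \<open>s0\<close> in
      the slice, and the lower limit ensures that \<open>s z > t\<close> implies
      \<open>s x > f x - \<delta>\<close>.\<close>
    obtain t where t: "t \<in> \<rat>" "f x - 3/4 * \<delta> < t" "t < f x - \<delta> / 2"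
      using Rats_dense_in_real[of "f x - 3/4 * \<delta>" "f x - \<delta> / 2"] \<open>\<delta> > 0\<close> by auto
    have "s0 \<in> sl (z, t)"
    proof -
      have "t < blinfun_apply s0 z" using near[OF A_norm[OF s0(1)]] s0(2) t(3) \<open>\<delta> > 0\<close> by linarith
      then show ?thesis using A_norm[OF s0(1)] by (simp add: sl_def)
    qed
    have "small (sl (z, t) \<inter> A)"
    proof (rule small_diam)
      have *: "norm (s - l) \<le> e / 4" if "s \<in> sl (z, t) \<inter> A" for s
      proof (rule close)
        show "s \<in> A" using that by blast
        have "norm s \<le> N" "t < blinfun_apply s z" using that by (auto simp: sl_def)
        with near[of s] t(2) show "blinfun_apply s x > f x - \<delta>" using \<open>\<delta> > 0\<close> by linarith
      qed
      fix a b assume "a \<in> sl (z, t) \<inter> A" "b \<in> sl (z, t) \<inter> A"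
      then show "dist a b \<le> e"
        using *[of a] *[of b] norm_triangle_ineq4[of "a - l" "b - l"] \<open>e > 0\<close> by (simp add: dist_norm)
    qed
    \<comment> \<open>Outside \<open>A\<close> the slice is contained in \<open>A0\<close>. So the
      whole slice is small and was among those removed, although it contains \<open>s0\<close> from
      \<open>A\<close>.\<close>
    then have "small (\<Union>{A0, sl (z, t) \<inter> A})" using \<open>small A0\<close> by (intro small_Union) auto
    then have "small (sl (z, t))" by (rule small_mono) (auto simp: A_def sl_def)
    then have "sl (z, t) \<subseteq> A0" using z t by (auto simp: A0_def)
    then show False using \<open>s0 \<in> sl (z, t)\<close> s0 by (auto simp: A_def)
  qed
  then have "small (cball 0 N)" using small_mono[OF \<open>small A0\<close>] by (auto simp: A_def)
  then show ?thesis by (simp add: small_def)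
qed

lemma asplund_dual_separable:
  fixes D :: "'a::banach set"
  assumes "asplund_space TYPE('a)" "countable D" "closure D = UNIV"
  obtains E :: "('a \<Rightarrow>\<^sub>L real) set" where "countable E" "closure E = UNIV"
proof -
  have "\<forall>n k. \<exists>\<U>. countable \<U> \<and> cball (0 :: 'a \<Rightarrow>\<^sub>L real) (real n) \<subseteq> \<Union>\<U>
      \<and> (\<forall>V\<in>\<U>. \<forall>a\<in>V. \<forall>b\<in>V. dist a b \<le> 1 / real (Suc k))"
    using asplund_dual_ball_cover[OF assms] by simp
  then obtain \<U> where \<U>: "\<And>n k. countable (\<U> n k)" "\<And>n k. cball (0 :: 'a \<Rightarrow>\<^sub>L real) (real n) \<subseteq> \<Union>(\<U> n k)"
    "\<And>n k V a b. V \<in> \<U> n k \<Longrightarrow> a \<in> V \<Longrightarrow> b \<in> V \<Longrightarrow> dist a b \<le> 1 / real (Suc k)"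
    by metis
  \<comment> \<open>One point from each covering set. An empty set contributes an arbitrary element,
    which does no harm to countability; the density argument only meets sets that contain the point
    to be approximated.\<close>
  define E where "E = (\<Union>n k. (\<lambda>V. SOME a. a \<in> V) ` \<U> n k)"
  have "countable E" unfolding E_def using \<U>(1) by auto
  moreover have "\<exists>b\<in>E. dist b a < e" if "e > 0" for a e
  proof -
    obtain k where k: "1 / real (Suc k) < e" using \<open>e > 0\<close> nat_approx_posE by blast
    obtain n where "norm a \<le> real n" using real_arch_simple by blast
    then obtain V where V: "V \<in> \<U> n k" "a \<in> V" using \<U>(2)[of n k] by auto
    then have "(SOME a. a \<in> V) \<in> V" by (intro someI)
    then have "dist (SOME a. a \<in> V) a < e" using \<U>(3)[OF V(1) _ V(2)] k by (meson le_less_trans)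
    moreover have "(SOME a. a \<in> V) \<in> E" using V unfolding E_def by blast
    ultimately show ?thesis by blast
  qed
  then have "closure E = UNIV" by (auto simp: closure_approachable)
  ultimately show ?thesis using that by blast
qed

section \<open>Locally uniformly convex functions\<close>

text \<open>
  The choice \<open>t + exp (- t)\<close> is convex, increasing and Lipschitz on \<open>[0, \<infinity>)\<close>, and its midpoint defect is a perfect
  square.
\<close>

definition softabs :: "real \<Rightarrow> real" where
  "softabs t = t + exp (- t)"

lemma softabs_mono: "0 \<le> s \<Longrightarrow> s \<le> t \<Longrightarrow> softabs s \<le> softabs t"
proof -
  assume "0 \<le> s" "s \<le> t"
  have *: "1 - exp (s - t) \<le> t - s" using exp_ge_add_one_self[of "s - t"] by linarith
  have "exp (- s) - exp (- t) = exp (- s) * (1 - exp (s - t))"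
    by (simp add: right_diff_distrib flip: exp_add)
  also have "\<dots> \<le> 1 * (t - s)"
    using \<open>0 \<le> s\<close> \<open>s \<le> t\<close> by (intro mult_mono *) auto
  finally show ?thesis by (simp add: softabs_def)
qed

lemma softabs_diff: "s \<le> t \<Longrightarrow> softabs t - softabs s \<le> t - s"
  by (simp add: softabs_def)

lemma softabs_nonneg: "0 \<le> t \<Longrightarrow> 0 \<le> softabs t"
  by (simp add: softabs_def add_nonneg_nonneg)

lemma softabs_le: "0 \<le> t \<Longrightarrow> softabs t \<le> 1 + t"
  by (simp add: softabs_def)

lemma softabs_convex: "0 \<le> t \<Longrightarrow> t \<le> 1 \<Longrightarrow>
    softabs ((1 - t) * a + t * b) \<le> (1 - t) * softabs a + t * softabs b"
  using convex_onD[OF exp_convex, of t "- a" "- b"] by (simp add: softabs_def algebra_simps)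

lemma softabs_midpoint_defect:
  "softabs a + softabs b - 2 * softabs ((a + b) / 2) = (exp (- a / 2) - exp (- b / 2))\<^sup>2"
proof -
  have "exp (- a) = (exp (- a / 2))\<^sup>2" "exp (- b) = (exp (- b / 2))\<^sup>2"
    by (simp_all add: power2_eq_square flip: exp_add)
  moreover have "exp (- ((a + b) / 2)) = exp (- a / 2) * exp (- b / 2)"
    by (simp add: add_divide_distrib flip: exp_add)
  ultimately show ?thesis unfolding softabs_def power2_diff by (simp add: field_simps)
qed

text \<open>The centres \<open>d n\<close> may be unbounded. Dividing by
  \<open>1 + norm (d n)\<close> compensates for this, because \<open>1 + norm x + norm (d n)\<close>
  is at most \<open>(1 + norm (d n)) * (1 + norm x)\<close>.\<close>

definition luc_term :: "(nat \<Rightarrow> 'e::real_normed_vector) \<Rightarrow> nat \<Rightarrow> 'e \<Rightarrow> real" where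
  "luc_term d n x = (1/2)^n / (1 + norm (d n)) * softabs (norm (x - d n))"

definition luc_sum :: "(nat \<Rightarrow> 'e::real_normed_vector) \<Rightarrow> 'e \<Rightarrow> real" where
  "luc_sum d x = (\<Sum>n. luc_term d n x)"

text \<open>The midpoint defect plays the role that \<open>2 - p (x + xs n)\<close> plays for a
  gauge \<open>p\<close> and boundary points. The sequence is not confined to a level set, so the
  notion survives the addition of a convex function and translation.\<close>

definition luc_function :: "('e::real_normed_vector \<Rightarrow> real) \<Rightarrow> bool" where
  "luc_function f \<longleftrightarrow> (\<forall>x xs. (\<lambda>n::nat. f x + f (xs n) - 2 * f ((1/2) *\<^sub>R (x + xs n))) \<longlonglongrightarrow> 0 \<longrightarrow> xs \<longlonglongrightarrow> x)"

lemma luc_weight: "0 < (1/2::real)^n / (1 + norm (d n))" "(1/2::real)^n / (1 + norm (d n)) \<le> (1/2)^n"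
proof -
  have "1 + norm (d n) \<ge> 1" by simp
  then show "0 < (1/2::real)^n / (1 + norm (d n))" "(1/2::real)^n / (1 + norm (d n)) \<le> (1/2)^n"
    by (auto intro!: divide_pos_pos simp: divide_le_eq_1 divide_simps simp del: norm_ge_zero)
qed

lemma luc_term_nonneg: "0 \<le> luc_term d n x"
  unfolding luc_term_def using less_imp_le[OF luc_weight(1)] by (intro mult_nonneg_nonneg softabs_nonneg) auto

lemma luc_term_le: "luc_term d n x \<le> (1/2)^n * (1 + norm x)"
proof -
  have "softabs (norm (x - d n)) \<le> 1 + norm x + norm (d n)"
    using softabs_le[of "norm (x - d n)"] norm_triangle_ineq4[of x "d n"] by simp
  also have "\<dots> \<le> (1 + norm (d n)) * (1 + norm x)" by (simp add: algebra_simps)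
  finally have "luc_term d n x \<le> (1/2)^n / (1 + norm (d n)) * ((1 + norm (d n)) * (1 + norm x))"
    unfolding luc_term_def by (rule mult_left_mono[OF _ less_imp_le[OF luc_weight(1)]])
  also have "1 + norm (d n) \<noteq> 0" using norm_ge_zero[of "d n"] by linarith
  then have "(1/2)^n / (1 + norm (d n)) * ((1 + norm (d n)) * (1 + norm x)) = (1/2)^n * (1 + norm x)" by simp
  finally show ?thesis .
qed

lemma sums_half: "(\<lambda>n. (1/2::real)^n * c) sums (2 * c)"
  using sums_mult2[OF geometric_sums[of "1/2::real"], of c] by simp

lemma summable_luc_term: "summable (\<lambda>n. luc_term d n x)"
  by (rule summable_comparison_test'[OF sums_summable[OF sums_half[of "1 + norm x"]], of 0])
     (use luc_term_nonneg[of d _ x] luc_term_le[of d _ x] in \<open>simp add: abs_of_nonneg\<close>)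

lemma luc_sum_nonneg: "0 \<le> luc_sum d x"
  unfolding luc_sum_def by (intro suminf_nonneg summable_luc_term luc_term_nonneg)

lemma luc_sum_le: "luc_sum d x \<le> 2 * (1 + norm x)"
  unfolding luc_sum_def sums_unique[OF sums_half[of "1 + norm x"]]
  by (intro suminf_le luc_term_le summable_luc_term sums_summable[OF sums_half])

lemma convex_on_luc_term: "convex_on UNIV (luc_term d n)"
proof
  fix t :: real and x y assume t: "0 < t" "t < 1"
  have "(1 - t) *\<^sub>R x + t *\<^sub>R y - d n = (1 - t) *\<^sub>R (x - d n) + t *\<^sub>R (y - d n)"
    by (simp add: algebra_simps)
  then have "norm ((1 - t) *\<^sub>R x + t *\<^sub>R y - d n) \<le> (1 - t) * norm (x - d n) + t * norm (y - d n)"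
    using norm_triangle_ineq[of "(1 - t) *\<^sub>R (x - d n)" "t *\<^sub>R (y - d n)"] t by simp
  then have "softabs (norm ((1 - t) *\<^sub>R x + t *\<^sub>R y - d n)) 
      \<le> softabs ((1 - t) * norm (x - d n) + t * norm (y - d n))"
    by (intro softabs_mono) auto
  also have "\<dots> \<le> (1 - t) * softabs (norm (x - d n)) + t * softabs (norm (y - d n))"
    using t by (intro softabs_convex) auto
  finally have "luc_term d n ((1 - t) *\<^sub>R x + t *\<^sub>R y)
      \<le> (1/2)^n / (1 + norm (d n)) * ((1 - t) * softabs (norm (x - d n)) + t * softabs (norm (y - d n)))"
    unfolding luc_term_def by (rule mult_left_mono[OF _ less_imp_le[OF luc_weight(1)]])
  then show "luc_term d n ((1 - t) *\<^sub>R x + t *\<^sub>R y) \<le> (1 - t) * luc_term d n x + t * luc_term d n y"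
    by (simp add: luc_term_def distrib_left mult.left_commute)
qed simp

lemma convex_on_suminf:
  fixes f :: "nat \<Rightarrow> 'a::real_vector \<Rightarrow> real"
  assumes "\<And>n. convex_on UNIV (f n)" and sm: "\<And>x. summable (\<lambda>n. f n x)"
  shows "convex_on UNIV (\<lambda>x. \<Sum>n. f n x)"
proof
  fix t :: real and x y assume t: "0 < t" "t < 1"
  have "(\<Sum>n. f n ((1 - t) *\<^sub>R x + t *\<^sub>R y)) \<le> (\<Sum>n. (1 - t) * f n x + t * f n y)"
    using t by (intro suminf_le convex_onD[OF assms(1)] summable_add summable_mult sm) auto
  also have "\<dots> = (1 - t) * (\<Sum>n. f n x) + t * (\<Sum>n. f n y)"
    by (simp add: suminf_add[symmetric] suminf_mult sm summable_mult)
  finally show "(\<Sum>n. f n ((1 - t) *\<^sub>R x + t *\<^sub>R y)) \<le> (1 - t) * (\<Sum>n. f n x) + t * (\<Sum>n. f n y)" .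
qed simp

lemma convex_on_luc_sum: "convex_on UNIV (luc_sum d)"
  using convex_on_suminf[OF convex_on_luc_term summable_luc_term] by (simp add: luc_sum_def[abs_def])

lemma luc_term_diff: "luc_term d n x - luc_term d n y \<le> (1/2)^n * norm (x - y)"
proof -
  have "softabs (norm (x - d n)) - softabs (norm (y - d n)) \<le> norm (x - y)"
  proof (cases "norm (y - d n) \<le> norm (x - d n)")
    case True
    then show ?thesis
      using softabs_diff[OF True] norm_triangle_ineq2[of "x - d n" "y - d n"] by simp
  next
    case False
    then have "softabs (norm (x - d n)) \<le> softabs (norm (y - d n))" by (intro softabs_mono) auto
    then show ?thesis using norm_ge_zero[of "x - y"] by linarith
  qed
  then have "luc_term d n x - luc_term d n y \<le> (1/2)^n / (1 + norm (d n)) * norm (x - y)"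
    unfolding luc_term_def right_diff_distrib[symmetric] by (rule mult_left_mono[OF _ less_imp_le[OF luc_weight(1)]])
  also have "\<dots> \<le> (1/2)^n * norm (x - y)" by (intro mult_right_mono luc_weight(2)) simp
  finally show ?thesis .
qed

lemma lipschitz_on_luc_sum: "2-lipschitz_on UNIV (luc_sum d)"
proof (rule lipschitz_onI)
  have *: "luc_sum d x - luc_sum d y \<le> 2 * norm (x - y)" for x y
    unfolding luc_sum_def suminf_diff[OF summable_luc_term summable_luc_term] sums_unique[OF sums_half[of "norm (x - y)"]]
    by (intro suminf_le luc_term_diff summable_diff summable_luc_term sums_summable[OF sums_half])
  show "dist (luc_sum d x) (luc_sum d y) \<le> 2 * dist x y" for x y
    using *[of x y] *[of y x] unfolding dist_norm real_norm_def norm_minus_commute[of y] by linarith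
qed simp

lemma luc_term_defect:
  "(1/2)^n / (1 + norm (d n)) * (exp (- norm (x - d n) / 2) - exp (- norm (y - d n) / 2))\<^sup>2
     \<le> luc_term d n x + luc_term d n y - 2 * luc_term d n ((1/2) *\<^sub>R (x + y))"
proof -
  have "(1/2) *\<^sub>R (x + y) - d n = (1/2) *\<^sub>R ((x - d n) + (y - d n))"
    by (simp add: algebra_simps flip: scaleR_2)
  then have "norm ((1/2) *\<^sub>R (x + y) - d n) \<le> (norm (x - d n) + norm (y - d n)) / 2"
    using norm_triangle_ineq[of "x - d n" "y - d n"] by simp
  then have "softabs (norm ((1/2) *\<^sub>R (x + y) - d n)) \<le> softabs ((norm (x - d n) + norm (y - d n)) / 2)"
    by (intro softabs_mono) auto
  then have "(exp (- norm (x - d n) / 2) - exp (- norm (y - d n) / 2))\<^sup>2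
     \<le> softabs (norm (x - d n)) + softabs (norm (y - d n)) - 2 * softabs (norm ((1/2) *\<^sub>R (x + y) - d n))"
    unfolding softabs_midpoint_defect[symmetric] by linarith
  from mult_left_mono[OF this less_imp_le[OF luc_weight(1)[of n d]]] show ?thesis
    by (simp add: luc_term_def right_diff_distrib distrib_left mult.left_commute)
qed

text \<open>All summands have nonnegative midpoint defects, so each single defect is bounded by that
  of the sum.\<close>

lemma luc_sum_defect:
  "(1/2)^n / (1 + norm (d n)) * (exp (- norm (x - d n) / 2) - exp (- norm (y - d n) / 2))\<^sup>2
     \<le> luc_sum d x + luc_sum d y - 2 * luc_sum d ((1/2) *\<^sub>R (x + y))"
proof -
  define t where "t n = luc_term d n x + luc_term d n y - 2 * luc_term d n ((1/2) *\<^sub>R (x + y))" for n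
  have t0: "0 \<le> t n" for n
    unfolding t_def
    by (rule order_trans[OF _ luc_term_defect])
       (intro mult_nonneg_nonneg zero_le_power2 less_imp_le[OF luc_weight(1)])
  have sm: "summable t" unfolding t_def by (intro summable_add summable_diff summable_mult summable_luc_term)
  have "t n \<le> suminf t" using sum_le_suminf[OF sm, of "{n}"] t0 by simp
  moreover have "suminf t = luc_sum d x + luc_sum d y - 2 * luc_sum d ((1/2) *\<^sub>R (x + y))"
    unfolding t_def luc_sum_def
    by (intro sums_unique[symmetric] sums_diff sums_add sums_mult summable_sums summable_luc_term)
  ultimately show ?thesis using luc_term_defect[of n d x y] by (simp add: t_def)
qed

lemma luc_function_luc_sum:
  fixes d :: "nat \<Rightarrow> 'e::real_normed_vector"
  assumes dense: "closure (range d) = UNIV"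
  shows "luc_function (luc_sum d)"
  unfolding luc_function_def
proof (intro allI impI)
  fix x :: 'e and xs :: "nat \<Rightarrow> 'e"
  assume lim: "(\<lambda>k. luc_sum d x + luc_sum d (xs k) - 2 * luc_sum d ((1/2) *\<^sub>R (x + xs k))) \<longlonglongrightarrow> 0"
  have norm_lim: "(\<lambda>k. norm (xs k - d n)) \<longlonglongrightarrow> norm (x - d n)" for n
  proof -
    define w where "w = (1/2::real)^n / (1 + norm (d n))"
    have "w > 0" using luc_weight(1) by (simp add: w_def)
    have "(\<lambda>k. w * (exp (- norm (x - d n) / 2) - exp (- norm (xs k - d n) / 2))\<^sup>2) \<longlonglongrightarrow> 0"
      by (rule tendsto_sandwich[OF _ _ tendsto_const lim])
         (use luc_sum_defect[of n d x] \<open>w > 0\<close> in \<open>auto simp: w_def intro!: always_eventually\<close>)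
    \<comment> \<open>The weight is fixed with \<open>n\<close> and can be divided out; square root
      and logarithm then recover the norms from the squared difference of exponentials.\<close>
    from tendsto_mult_left[OF this, of "1 / w"]
    have "(\<lambda>k. (exp (- norm (x - d n) / 2) - exp (- norm (xs k - d n) / 2))\<^sup>2) \<longlonglongrightarrow> 0"
      using \<open>w > 0\<close> by simp
    from tendsto_real_sqrt[OF this]
    have "(\<lambda>k. exp (- norm (x - d n) / 2) - exp (- norm (xs k - d n) / 2)) \<longlonglongrightarrow> 0"
      by (simp add: tendsto_rabs_zero_iff)
    from tendsto_diff[OF tendsto_const[of "exp (- norm (x - d n) / 2)"] this]
    have "(\<lambda>k. exp (- norm (xs k - d n) / 2)) \<longlonglongrightarrow> exp (- norm (x - d n) / 2)" by simp
    from tendsto_ln[OF this]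
    have "(\<lambda>k. - norm (xs k - d n) / 2) \<longlonglongrightarrow> - norm (x - d n) / 2" by simp
    from tendsto_mult_left[OF this, of "-2"] show ?thesis by simp
  qed
  show "xs \<longlonglongrightarrow> x"
  proof (rule tendstoI)
    fix e :: real assume "e > 0"
    \<comment> \<open>One centre near \<open>x\<close> is enough: the distances of
      \<open>xs k\<close> to it converge to that of \<open>x\<close>, so \<open>xs k\<close> is
      eventually within \<open>e / 2\<close> of the same centre.\<close>
    have "x \<in> closure (range d)" using dense by simp
    moreover have "e / 2 > 0" using \<open>e > 0\<close> by simp
    ultimately obtain n where n: "dist (d n) x < e / 2" unfolding closure_approachable by (metis rangeE)
    have "\<forall>\<^sub>F k in sequentially. norm (xs k - d n) < e / 2"
      using n by (intro order_tendstoD(2)[OF norm_lim]) (simp add: dist_norm norm_minus_commute)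
    then show "\<forall>\<^sub>F k in sequentially. dist (xs k) x < e"
    proof eventually_elim
      case (elim k)
      then show ?case using n dist_triangle[of "xs k" x "d n"] by (simp add: dist_norm)
    qed
  qed
qed

section \<open>Weak-star lower semicontinuity on the dual\<close>

lemma norm_weak_star_lsc:
  fixes s :: "nat \<Rightarrow> 'a::real_normed_vector \<Rightarrow>\<^sub>L real"
  assumes lim: "\<And>y. (\<lambda>k. blinfun_apply (s k) y) \<longlonglongrightarrow> blinfun_apply a y" and "\<eta> > 0"
  shows "\<forall>\<^sub>F k in sequentially. norm a - \<eta> < norm (s k)"
proof (cases "norm a - \<eta> < 0")
  case True
  then show ?thesis by (intro always_eventually allI less_le_trans[OF _ norm_ge_zero])
next
  case False
  \<comment> \<open>A vector on which \<open>a\<close> nearly attains its norm; convergence at this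
    single vector bounds \<open>norm (s k)\<close> from below.\<close>
  have "\<exists>y. norm (blinfun_apply a y) > (norm a - \<eta>) * norm y"
  proof (rule ccontr)
    assume "\<not> ?thesis"
    then have "norm a \<le> norm a - \<eta>" using False by (intro norm_blinfun_bound) (auto simp: not_less)
    then show False using \<open>\<eta> > 0\<close> by simp
  qed
  then obtain y where y: "norm (blinfun_apply a y) > (norm a - \<eta>) * norm y" by blast
  have "\<forall>\<^sub>F k in sequentially. norm (blinfun_apply (s k) y) > (norm a - \<eta>) * norm y"
    by (rule order_tendstoD(1)[OF tendsto_norm[OF lim] y])
  then show ?thesis
  proof eventually_elim
    case (elim k)
    then have "(norm a - \<eta>) * norm y < norm (s k) * norm y" using norm_blinfun[of "s k" y] by linarith
    then show ?case by (rule mult_right_less_imp_less) simp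
  qed
qed

text \<open>A finite partial sum at \<open>a\<close> already exceeds \<open>c\<close>. In each of
  its \<open>N\<close> terms the passage to \<open>s k\<close> eventually loses at most
  \<open>\<eta>\<close>, since the weights are at most 1 and \<open>softabs\<close> is increasing
  and 1-Lipschitz on nonnegative numbers; \<open>\<eta>\<close> is chosen so that
  \<open>N * \<eta>\<close> stays below the excess.\<close>

lemma luc_sum_weak_star_lsc:
  fixes s :: "nat \<Rightarrow> 'a::real_normed_vector \<Rightarrow>\<^sub>L real"
  assumes lim: "\<And>y. (\<lambda>k. blinfun_apply (s k) y) \<longlonglongrightarrow> blinfun_apply a y" and "c < luc_sum d a"
  shows "\<forall>\<^sub>F k in sequentially. c < luc_sum d (s k)"
proof -
  have "(\<lambda>N. \<Sum>n<N. luc_term d n a) \<longlonglongrightarrow> luc_sum d a"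
    unfolding luc_sum_def by (rule summable_LIMSEQ[OF summable_luc_term])
  from order_tendstoD(1)[OF this \<open>c < _\<close>] obtain N where N: "c < (\<Sum>n<N. luc_term d n a)"
    by (auto simp: eventually_sequentially)
  define \<eta> where "\<eta> = ((\<Sum>n<N. luc_term d n a) - c) / (real N + 1)"
  have "\<eta> > 0" using N by (simp add: \<eta>_def)
  have "N * \<eta> < (\<Sum>n<N. luc_term d n a) - c" using N by (simp add: \<eta>_def field_simps)
  have "\<forall>\<^sub>F k in sequentially. luc_term d n a - \<eta> \<le> luc_term d n (s k)" for n
  proof -
    have "\<And>y. (\<lambda>k. blinfun_apply (s k - d n) y) \<longlonglongrightarrow> blinfun_apply (a - d n) y"
      unfolding blinfun.diff_left by (intro tendsto_intros lim)
    from norm_weak_star_lsc[OF this \<open>\<eta> > 0\<close>] show ?thesis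
    proof eventually_elim
      case (elim k)
      have "softabs (norm (a - d n)) - softabs (norm (s k - d n)) \<le> \<eta>"
        using elim softabs_diff[of "norm (s k - d n)" "norm (a - d n)"] 
          softabs_mono[of "norm (a - d n)" "norm (s k - d n)"] \<open>\<eta> > 0\<close>
        by (cases "norm (s k - d n) \<le> norm (a - d n)") auto
      then have "luc_term d n a - luc_term d n (s k) \<le> (1/2)^n / (1 + norm (d n)) * \<eta>"
        unfolding luc_term_def right_diff_distrib[symmetric] by (rule mult_left_mono[OF _ less_imp_le[OF luc_weight(1)]])
      also have "\<dots> \<le> 1 * \<eta>"
        using luc_weight(2)[of n d] \<open>\<eta> > 0\<close> power_le_one[of "1/2::real" n] by (intro mult_right_mono) auto
      finally show ?case by simp
    qed
  qed
  then have "\<forall>\<^sub>F k in sequentially. \<forall>n\<in>{..<N}. luc_term d n a - \<eta> \<le> luc_term d n (s k)"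
    by (intro eventually_ball_finite) auto
  then show ?thesis
  proof eventually_elim
    case (elim k)
    have "(\<Sum>n<N. luc_term d n a - \<eta>) \<le> (\<Sum>n<N. luc_term d n (s k))" using elim by (intro sum_mono) auto
    also have "\<dots> \<le> luc_sum d (s k)"
      unfolding luc_sum_def by (intro sum_le_suminf summable_luc_term luc_term_nonneg) auto
    finally show ?case using \<open>N * \<eta> < _\<close> by (simp add: sum_subtractf)
  qed
qed

section \<open>Smoothing of Lipschitz convex functions\<close>

text \<open>Sequential weak-star compactness of dual balls: a diagonal argument gives convergence on
  \<open>D\<close>, and the common Lipschitz constant extends it to all vectors.\<close>

lemma blinfun_pointwise_sequentially_compact:
  fixes s :: "nat \<Rightarrow> 'a::real_normed_vector \<Rightarrow>\<^sub>L real"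
  assumes D: "countable D" "closure D = (UNIV :: 'a set)" and L: "\<And>n. norm (s n) \<le> L"
  obtains k a where "strict_mono k" "\<And>y. (\<lambda>n. blinfun_apply (s (k n)) y) \<longlonglongrightarrow> blinfun_apply a y" "norm a \<le> L"
proof -
  have L0: "L \<ge> 0" using L[of 0] norm_ge_zero order_trans by blast
  have bound: "\<bar>blinfun_apply (s n) y\<bar> \<le> L * norm y" for n y
  proof -
    have "\<bar>blinfun_apply (s n) y\<bar> \<le> norm (s n) * norm y" using norm_blinfun[of "s n" y] by simp
    also have "\<dots> \<le> L * norm y" by (intro mult_right_mono L) simp
    finally show ?thesis .
  qed
  \<comment> \<open>Division by \<open>1 + norm y\<close> yields a bound uniform in
    \<open>y\<close>, as the diagonal selection demands.\<close>
  have "norm (blinfun_apply (s n) y / (1 + norm y)) \<le> L" for n y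
  proof -
    have p: "1 + norm y > 0" using norm_ge_zero[of y] by linarith
    have "\<bar>blinfun_apply (s n) y\<bar> \<le> L * (1 + norm y)" using bound[of n y] L0 by (simp add: distrib_left)
    then show ?thesis using p by (simp add: abs_divide pos_divide_le_eq)
  qed
  then obtain k where k: "strict_mono k"
    "\<And>y. y \<in> D \<Longrightarrow> \<exists>l. (\<lambda>n. blinfun_apply (s (k n)) y / (1 + norm y)) \<longlonglongrightarrow> l"
    using function_convergent_subsequence[OF D(1), of "\<lambda>n y. blinfun_apply (s n) y / (1 + norm y)" L] by metis
  have conv_D: "Cauchy (\<lambda>n. blinfun_apply (s (k n)) y)" if y: "y \<in> D" for y
  proof -
    have p: "1 + norm y \<noteq> 0" using norm_ge_zero[of y] by linarith
    obtain l where "(\<lambda>n. blinfun_apply (s (k n)) y / (1 + norm y)) \<longlonglongrightarrow> l" using k(2)[OF y] by blast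
    from tendsto_mult_right[OF this, of "1 + norm y"]
    have "(\<lambda>n. blinfun_apply (s (k n)) y) \<longlonglongrightarrow> l * (1 + norm y)" using p by simp
    then show ?thesis by (rule LIMSEQ_imp_Cauchy)
  qed
  have "Cauchy (\<lambda>n. blinfun_apply (s (k n)) y)" for y
  proof (rule metric_CauchyI)
    fix e :: real assume "e > 0"
    define \<eta> where "\<eta> = e / (3 * (L + 1))"
    have "\<eta> > 0" using \<open>e > 0\<close> L0 by (simp add: \<eta>_def)
    have "(L + 1) * \<eta> = e / 3" using L0 by (simp add: \<eta>_def) (simp add: field_simps)
    moreover have "L * \<eta> \<le> (L + 1) * \<eta>" using \<open>\<eta> > 0\<close> by simp
    ultimately have L\<eta>: "L * \<eta> \<le> e / 3" by linarith
    have "y \<in> closure D" using D by simp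
    then obtain z where z: "z \<in> D" "dist z y < \<eta>" using \<open>\<eta> > 0\<close> unfolding closure_approachable by metis
    have near: "\<bar>blinfun_apply (s n) z - blinfun_apply (s n) y\<bar> \<le> e / 3" for n
    proof -
      have "\<bar>blinfun_apply (s n) (z - y)\<bar> \<le> L * norm (z - y)" by (rule bound)
      also have "\<dots> \<le> L * \<eta>" using z L0 by (intro mult_left_mono) (auto simp: dist_norm)
      finally show ?thesis using L\<eta> by (simp add: blinfun.diff_right)
    qed
    obtain M where M: "\<And>m n. m \<ge> M \<Longrightarrow> n \<ge> M \<Longrightarrow>
        dist (blinfun_apply (s (k m)) z) (blinfun_apply (s (k n)) z) < e / 3"
      using metric_CauchyD[OF conv_D[OF z(1)], of "e / 3"] \<open>e > 0\<close> by auto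
    have "dist (blinfun_apply (s (k m)) y) (blinfun_apply (s (k n)) y) < e" if "m \<ge> M" "n \<ge> M" for m n
      using M[OF that] near[of "k m"] near[of "k n"] unfolding dist_real_def by linarith
    then show "\<exists>M. \<forall>m\<ge>M. \<forall>n\<ge>M. dist (blinfun_apply (s (k m)) y) (blinfun_apply (s (k n)) y) < e" by blast
  qed
  then have "\<forall>y. \<exists>l. (\<lambda>n. blinfun_apply (s (k n)) y) \<longlonglongrightarrow> l"
    by (simp add: Cauchy_convergent_iff convergent_def)
  then obtain A where A: "\<And>y. (\<lambda>n. blinfun_apply (s (k n)) y) \<longlonglongrightarrow> A y" by metis
  have A_bound: "\<bar>A y\<bar> \<le> L * norm y" for y
    by (rule tendsto_upperbound[OF tendsto_rabs[OF A]]) (auto intro: always_eventually bound)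
  have "bounded_linear A"
  proof (rule bounded_linear_intro)
    show "A (x + y) = A x + A y" for x y
      by (rule LIMSEQ_unique[OF A]) (unfold blinfun.add_right, intro tendsto_intros A)
    show "A (r *\<^sub>R x) = r *\<^sub>R A x" for r x
      by (rule LIMSEQ_unique[OF A]) (unfold blinfun.scaleR_right, intro tendsto_intros A)
    show "norm (A x) \<le> norm x * L" for x using A_bound[of x] by (simp add: mult.commute)
  qed
  then have "blinfun_apply (Blinfun A) = A" by (rule bounded_linear_Blinfun_apply)
  moreover from this have "norm (Blinfun A) \<le> L" using A_bound L0 by (intro norm_blinfun_bound) auto
  ultimately show ?thesis using that[of k "Blinfun A"] k(1) A by simp
qed

lemma asplund_affine_minorant:
  fixes f :: "'a::banach \<Rightarrow> real"
  assumes asplund: "asplund_space TYPE('a)" and f: "convex_on UNIV f" "L-lipschitz_on UNIV f" and "\<eta> > 0"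
  obtains s :: "'a \<Rightarrow>\<^sub>L real" and c where "norm s \<le> L" "\<And>y. blinfun_apply s y + c \<le> f y" "f x - \<eta> < blinfun_apply s x + c"
proof -
  have L0: "L \<ge> 0" using f(2) by (rule lipschitz_on_nonneg)
  have fL: "\<bar>f x - f y\<bar> \<le> L * norm (x - y)" for x y
    using lipschitz_onD[OF f(2), of x y] by (simp add: dist_norm)
  \<comment> \<open>Moving from \<open>x\<close> to the point of differentiability \<open>z\<close>
    costs at most \<open>L * \<rho>\<close> for \<open>f\<close> and as much for the slope, in total
    less than \<open>\<eta>\<close>.\<close>
  define \<rho> where "\<rho> = \<eta> / (2 * (L + 1))"
  have "\<rho> > 0" using \<open>\<eta> > 0\<close> L0 by (simp add: \<rho>_def)
  have "2 * ((L + 1) * \<rho>) = \<eta>" using L0 by (simp add: \<rho>_def field_simps)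
  then have L\<rho>: "2 * (L * \<rho>) < \<eta>" using \<open>\<rho> > 0\<close> by (simp add: distrib_right)
  obtain z and s :: "'a \<Rightarrow>\<^sub>L real" where z: "dist z x < \<rho>" and s: "(f has_derivative blinfun_apply s) (at z)"
    using asplund_dense_derivative[OF asplund f(1) lipschitz_on_continuous_on[OF f(2)] \<open>\<rho> > 0\<close>, of x] by metis
  have sub: "f z + blinfun_apply s (y - z) \<le> f y" for y by (rule convex_on_subgradient[OF f(1) s])
  have s_le: "\<bar>blinfun_apply s h\<bar> \<le> L * norm h" for h
    using sub[of "z + h"] sub[of "z - h"] fL[of "z + h" z] fL[of "z - h" z]
    by (simp add: blinfun.minus_right abs_le_iff)
  show ?thesis
  proof
    show "norm s \<le> L" using s_le L0 by (intro norm_blinfun_bound) auto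
    show "blinfun_apply s y + (f z - blinfun_apply s z) \<le> f y" for y
      using sub[of y] by (simp add: blinfun.diff_right)
    have "L * norm (z - x) \<le> L * \<rho>" using z L0 by (intro mult_left_mono) (auto simp: dist_norm)
    then show "f x - \<eta> < blinfun_apply s x + (f z - blinfun_apply s z)"
      using s_le[of "z - x"] fL[of z x] L\<rho> by (simp add: blinfun.diff_right)
  qed
qed

text \<open>
  The regularisation is the predual conjugate of the conjugate of \<open>f\<close> plus a small multiple of a
  weak-star lower semicontinuous locally uniformly convex function: the supremum is attained, and
  every maximising sequence converges in norm to the maximiser, which is therefore the derivative.
\<close>

lemma asplund_smoothing:
  fixes f :: "'a::banach \<Rightarrow> real"
  assumes asplund: "asplund_space TYPE('a)" and D: "countable D" "closure D = (UNIV :: 'a set)"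
    and f: "convex_on UNIV f" "L-lipschitz_on UNIV f" and "\<delta> > 0"
  obtains g where "convex_on UNIV g" "L-lipschitz_on UNIV g" "\<And>x. g x \<le> f x" "\<And>x. f x - \<delta> \<le> g x"
    "\<And>x. g differentiable (at x)"
proof -
  have L0: "L \<ge> 0" using f(2) by (rule lipschitz_on_nonneg)
  obtain E :: "('a \<Rightarrow>\<^sub>L real) set" where E: "countable E" "closure E = UNIV"
    using asplund_dual_separable[OF asplund D] by metis
  have "E \<noteq> {}" using E(2) by auto
  define d where "d = from_nat_into E"
  have "range d = E" unfolding d_def using range_from_nat_into[OF \<open>E \<noteq> {}\<close> E(1)] .
  with E(2) have d: "closure (range d) = UNIV" by simp
  define Q where "Q = luc_sum d"
  \<comment> \<open>For slopes of norm at most \<open>L\<close> the penalty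
    \<open>\<beta> * Q\<close> is then at most \<open>\<delta> / 2\<close>; the other half of
    \<open>\<delta>\<close> pays for the affine minorant.\<close>
  define \<beta> where "\<beta> = \<delta> / (4 * (1 + L))"
  have "\<beta> > 0" using \<open>\<delta> > 0\<close> L0 by (simp add: \<beta>_def)
  \<comment> \<open>Pairs of slope and constant stand for the conjugate: for a fixed slope
    \<open>s\<close> the largest admissible constant is minus the conjugate of \<open>f\<close> at
    \<open>s\<close>. This avoids infinite values, and \<open>I\<close> is convex.\<close>
  define I where "I = {i :: ('a \<Rightarrow>\<^sub>L real) \<times> real. norm (fst i) \<le> L \<and> (\<forall>y. blinfun_apply (fst i) y + snd i \<le> f y)}"
  define c where "c i = snd i - \<beta> * Q (fst i)" for i
  have Q0: "0 \<le> \<beta> * Q s" for s using \<open>\<beta> > 0\<close> luc_sum_nonneg[of d s] by (simp add: Q_def)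
  have QL: "\<beta> * Q (fst i) \<le> \<delta> / 2" if "i \<in> I" for i
  proof -
    have "Q (fst i) \<le> 2 * (1 + norm (fst i))" unfolding Q_def by (rule luc_sum_le)
    also have "\<dots> \<le> 2 * (1 + L)" using that by (simp add: I_def)
    finally have "\<beta> * Q (fst i) \<le> \<beta> * (2 * (1 + L))" using \<open>\<beta> > 0\<close> by simp
    also have "\<dots> = \<delta> / 2" using L0 by (simp add: \<beta>_def divide_simps)
    finally show ?thesis .
  qed
  have minorant: "\<exists>i\<in>I. f x - \<eta> < blinfun_apply (fst i) x + snd i" if \<eta>: "\<eta> > 0" for x \<eta>
  proof -
    obtain s :: "'a \<Rightarrow>\<^sub>L real" and c where "norm s \<le> L" "\<And>y. blinfun_apply s y + c \<le> f y" "f x - \<eta> < blinfun_apply s x + c"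
      using asplund_affine_minorant[OF asplund f \<eta>, of x] by metis
    then show ?thesis by (intro bexI[of _ "(s, c)"]) (auto simp: I_def)
  qed
  then have "I \<noteq> {}" using zero_less_one by blast
  have le_f: "blinfun_apply (fst i) x + c i \<le> f x" if "i \<in> I" for i x
    using that Q0[of "fst i"] by (force simp: I_def c_def intro: order_trans[rotated])
  have bdd: "bdd_above ((\<lambda>i. blinfun_apply (fst i) x + c i) ` I)" for x
    by (rule bdd_aboveI2) (rule le_f)
  define g where "g x = (SUP i\<in>I. blinfun_apply (fst i) x + c i)" for x
  have g_ge: "blinfun_apply (fst i) x + c i \<le> g x" if "i \<in> I" for i x
    unfolding g_def by (rule cSUP_upper[OF that bdd])
  have g_approx: "\<exists>i\<in>I. g x - \<eta> < blinfun_apply (fst i) x + c i" if "\<eta> > 0" for x \<eta>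
  proof -
    have "g x - \<eta> < (SUP i\<in>I. blinfun_apply (fst i) x + c i)" using that by (simp add: g_def)
    then show ?thesis using less_cSUP_iff[OF \<open>I \<noteq> {}\<close> bdd[of x]] by blast
  qed
  have g_lip: "L-lipschitz_on UNIV g"
    unfolding g_def[abs_def] by (rule lipschitz_on_SUP_affine[OF \<open>I \<noteq> {}\<close> bdd]) (simp add: I_def)
  have gL: "\<bar>g x - g y\<bar> \<le> L * norm (x - y)" for x y
    using lipschitz_onD[OF g_lip, of x y] by (simp add: dist_norm)
  have attained: "\<exists>i\<in>I. blinfun_apply (fst i) x + c i = g x" for x
  proof -
    have "\<forall>n::nat. \<exists>i\<in>I. g x - 1 / real (Suc n) < blinfun_apply (fst i) x + c i" by (intro allI g_approx) simp
    then obtain i where i: "\<And>n. i n \<in> I" "\<And>n. g x - 1 / real (Suc n) < blinfun_apply (fst (i n)) x + c (i n)" by metis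
    have iL: "norm (fst (i n)) \<le> L" for n using i(1)[of n] by (simp add: I_def)
    have i0: "blinfun_apply (fst (i n)) y + snd (i n) \<le> f y" for n y using i(1)[of n] by (simp add: I_def)
    obtain k a where k: "strict_mono k" and a: "\<And>y. (\<lambda>n. blinfun_apply (fst (i (k n))) y) \<longlonglongrightarrow> blinfun_apply a y"
      and aL: "norm a \<le> L"
      using blinfun_pointwise_sequentially_compact[OF D, of "\<lambda>n. fst (i n)" L] iL by metis
    \<comment> \<open>Evaluation at 0 bounds the constants from above, near maximality at
      \<open>x\<close> bounds them from below.\<close>
    have snd_bound: "snd (i n) \<in> {g x - 1 - L * norm x .. f 0}" for n
    proof -
      have "snd (i n) \<le> f 0" using i0[of n 0] by simp
      moreover have "\<bar>blinfun_apply (fst (i n)) x\<bar> \<le> L * norm x"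
        using norm_blinfun[of "fst (i n)" x] mult_right_mono[OF iL[of n] norm_ge_zero[of x]] by simp
      moreover have "1 / real (Suc n) \<le> 1" by simp
      ultimately show ?thesis using i(2)[of n] Q0[of "fst (i n)"] unfolding c_def atLeastAtMost_iff by linarith
    qed
    obtain m b where m: "strict_mono m" and b: "((\<lambda>n. snd (i (k n))) \<circ> m) \<longlonglongrightarrow> b"
      using compact_Icc[of "g x - 1 - L * norm x" "f 0", unfolded compact_def, rule_format, of "\<lambda>n. snd (i (k n))"]
        snd_bound by blast
    define j where "j n = i (k (m n))" for n
    have a': "(\<lambda>n. blinfun_apply (fst (j n)) y) \<longlonglongrightarrow> blinfun_apply a y" for y
      using LIMSEQ_subseq_LIMSEQ[OF a m] by (simp add: j_def o_def)
    have b': "(\<lambda>n. snd (j n)) \<longlonglongrightarrow> b" using b by (simp add: j_def o_def)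
    have "(a, b) \<in> I"
    proof -
      have "blinfun_apply a y + b \<le> f y" for y
        by (rule tendsto_upperbound[OF tendsto_add[OF a' b']]) (use i0 in \<open>auto simp: j_def\<close>)
      with aL show ?thesis by (simp add: I_def)
    qed
    moreover have "g x \<le> blinfun_apply a x + c (a, b)"
    proof (rule ccontr)
      assume "\<not> g x \<le> blinfun_apply a x + c (a, b)"
      have km: "strict_mono (k \<circ> m)" using k m by (rule strict_mono_o)
      from \<open>\<not> g x \<le> _\<close> have "\<beta> * Q a > blinfun_apply a x + b - g x" by (simp add: c_def)
      \<comment> \<open>A quarter of the supposed shortfall. Lower semicontinuity of
        \<open>Q\<close>, convergence of the affine part and near maximality each lose less than
        \<open>\<eta>\<close>, so three quarters cannot cover the gap.\<close>
      define \<eta> where "\<eta> = (\<beta> * Q a - (blinfun_apply a x + b - g x)) / 4"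
      have "\<eta> > 0" using \<open>\<beta> * Q a > _\<close> by (simp add: \<eta>_def)
      have "Q a - \<eta> / \<beta> < luc_sum d a" using \<open>\<eta> > 0\<close> \<open>\<beta> > 0\<close> by (simp add: Q_def)
      from luc_sum_weak_star_lsc[OF a' this]
      have "\<forall>\<^sub>F n in sequentially. Q a - \<eta> / \<beta> < Q (fst (j n))" by (simp add: Q_def)
      moreover have "\<forall>\<^sub>F n in sequentially. blinfun_apply (fst (j n)) x + snd (j n) < blinfun_apply a x + b + \<eta>"
        using \<open>\<eta> > 0\<close> by (intro order_tendstoD(2)[OF tendsto_add[OF a' b']]) simp
      moreover have "\<forall>\<^sub>F n in sequentially. 1 / real (Suc n) < \<eta>"
        using order_tendstoD(2)[OF LIMSEQ_inverse_real_of_nat \<open>\<eta> > 0\<close>] by (simp add: inverse_eq_divide)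
      ultimately have "\<forall>\<^sub>F n in sequentially. False"
      proof eventually_elim
        case (elim n)
        have "n \<le> k (m n)" using strict_mono_imp_increasing[OF km, of n] by simp
        then have "1 / real (Suc (k (m n))) \<le> 1 / real (Suc n)" by (intro divide_left_mono) auto
        moreover have "\<beta> * Q a - \<eta> < \<beta> * Q (fst (j n))"
          using mult_strict_left_mono[OF elim(1) \<open>\<beta> > 0\<close>] \<open>\<beta> > 0\<close> by (simp add: right_diff_distrib)
        moreover have "4 * \<eta> = \<beta> * Q a - (blinfun_apply a x + b - g x)" by (simp add: \<eta>_def)
        ultimately show False
          using elim(2,3) i(2)[of "k (m n)"] \<open>\<eta> > 0\<close> unfolding c_def j_def[symmetric] by linarith
      qed
      then show False by simp
    qed
    ultimately show ?thesis using g_ge[of "(a, b)" x] by (intro bexI[of _ "(a, b)"]) auto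
  qed
  have "g differentiable (at x)" for x
  proof -
    obtain a b where ab: "(a, b) \<in> I" "blinfun_apply a x + c (a, b) = g x" using attained[of x] by force
    \<comment> \<open>The maximiser supports \<open>g\<close> at \<open>x\<close>, so the estimate
      from below holds without error and only the one from above is left.\<close>
    have lower: "blinfun_apply a h \<le> g (x + h) - g x" for h
      using g_ge[OF ab(1), of "x + h"] ab(2) by (simp add: blinfun.add_right)
    have "\<exists>r>0. \<forall>h. norm h < r \<longrightarrow> g (x + h) - g x - blinfun_apply a h \<le> e * norm h" if "e > 0" for e
    proof (rule ccontr)
      assume *: "\<not> ?thesis"
      have "\<forall>n::nat. \<exists>h. norm h < 1 / real (Suc n) \<and> e * norm h < g (x + h) - g x - blinfun_apply a h"
      proof
        fix n :: nat
        have "1 / real (Suc n) > 0" by simp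
        with * show "\<exists>h. norm h < 1 / real (Suc n) \<and> e * norm h < g (x + h) - g x - blinfun_apply a h"
          by (meson not_le)
      qed
      then obtain h where h: "\<And>n::nat. norm (h n) < 1 / real (Suc n)"
        "\<And>n. e * norm (h n) < g (x + h n) - g x - blinfun_apply a (h n)" by metis
      have h0: "norm (h n) > 0" for n using h(2)[of n] by (cases "h n = 0") auto
      have hlim: "(\<lambda>n. norm (h n)) \<longlonglongrightarrow> 0"
        by (rule tendsto_sandwich[OF _ _ tendsto_const LIMSEQ_inverse_real_of_nat])
           (auto simp: inverse_eq_divide intro!: always_eventually less_imp_le[OF h(1), unfolded of_nat_Suc])
      \<comment> \<open>The tolerance is half of the assumed excess \<open>e * norm (h n)\<close>;
        the remaining half keeps the slopes \<open>s n\<close> away from \<open>a\<close>.\<close>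
      have "\<forall>n. \<exists>i\<in>I. g (x + h n) - e / 2 * norm (h n) < blinfun_apply (fst i) (x + h n) + c i"
        using h0 \<open>e > 0\<close> by (intro allI g_approx) simp
      then obtain i where i: "\<And>n. i n \<in> I"
        "\<And>n. g (x + h n) - e / 2 * norm (h n) < blinfun_apply (fst (i n)) (x + h n) + c (i n)" by metis
      define s where "s n = fst (i n)" for n
      have far: "norm (s n - a) > e / 2" for n
      proof -
        have "blinfun_apply (s n) (x + h n) = blinfun_apply (s n) x + blinfun_apply (s n) (h n)"
          by (rule blinfun.add_right)
        then have "e / 2 * norm (h n) < blinfun_apply (s n - a) (h n)"
          using i(2)[of n] h(2)[of n] g_ge[OF i(1)[of n], of x] unfolding s_def[symmetric] blinfun.diff_left by linarith
        also have "\<dots> \<le> norm (s n - a) * norm (h n)" using norm_blinfun[of "s n - a" "h n"] by simp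
        finally show ?thesis using h0[of n] by simp
      qed
      have defect: "Q a + Q (s n) - 2 * Q ((1/2) *\<^sub>R (a + s n)) \<le> (2 * L + e / 2) / \<beta> * norm (h n)" for n
      proof -
        \<comment> \<open>The midpoint of two minorants is again a minorant, so its penalised value
          at \<open>x\<close> is at most \<open>g x\<close>. Compared with the mean of the two
          values it gains half of \<open>\<beta>\<close> times the defect of \<open>Q\<close>; this
          gain is therefore bounded by the shortfall of \<open>i n\<close> at \<open>x\<close>,
          which is of order \<open>norm (h n)\<close>.\<close>
        define mid where "mid = ((1/2) *\<^sub>R (a + s n), (b + snd (i n)) / 2)"
        have "mid \<in> I"
        proof -
          have "norm (a + s n) \<le> 2 * L"
            using norm_triangle_ineq[of a "s n"] ab(1) i(1)[of n] by (simp add: I_def s_def)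
          moreover have "blinfun_apply a y + b \<le> f y" "blinfun_apply (s n) y + snd (i n) \<le> f y" for y
            using ab(1) i(1)[of n] by (auto simp: I_def s_def)
          ultimately show ?thesis
            by (auto simp: I_def mid_def blinfun.scaleR_left blinfun.add_left add_divide_distrib
                intro: order_trans[OF _ add_mono[of _ "f _ / 2" _ "f _ / 2"]]) (smt (verit) field_sum_of_halves)
        qed
        from g_ge[OF this, of x] have 1: "2 * (blinfun_apply (fst mid) x + c mid) \<le> 2 * g x" by simp
        have 2: "2 * (blinfun_apply (fst mid) x + c mid)
            = (blinfun_apply a x + c (a, b)) + (blinfun_apply (s n) x + c (i n))
              + \<beta> * (Q a + Q (s n) - 2 * Q ((1/2) *\<^sub>R (a + s n)))"
          unfolding mid_def c_def s_def
          by (simp add: blinfun.scaleR_left blinfun.add_left algebra_simps)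
        have 3: "\<bar>blinfun_apply (s n) (h n)\<bar> \<le> L * norm (h n)"
          using norm_blinfun[of "s n" "h n"] mult_right_mono[of "norm (s n)" L "norm (h n)"] i(1)[of n]
          by (simp add: I_def s_def)
        have "\<bar>g (x + h n) - g x\<bar> \<le> L * norm (h n)" using gL[of "x + h n" x] by simp
        then have "\<beta> * (Q a + Q (s n) - 2 * Q ((1/2) *\<^sub>R (a + s n))) \<le> 2 * (L * norm (h n)) + e / 2 * norm (h n)"
          using 1 2 3 i(2)[of n] ab(2) unfolding s_def[symmetric] blinfun.add_right by linarith
        then show ?thesis using \<open>\<beta> > 0\<close> by (simp add: field_simps)
      qed
      have "(\<lambda>n. Q a + Q (s n) - 2 * Q ((1/2) *\<^sub>R (a + s n))) \<longlonglongrightarrow> 0"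
      proof (rule tendsto_sandwich[OF _ _ tendsto_const])
        show "(\<lambda>n. (2 * L + e / 2) / \<beta> * norm (h n)) \<longlonglongrightarrow> 0" by (rule tendsto_mult_right_zero[OF hlim])
        show "\<forall>\<^sub>F n in sequentially. 0 \<le> Q a + Q (s n) - 2 * Q ((1/2) *\<^sub>R (a + s n))"
          using convex_on_midpoint[OF convex_on_luc_sum[of d], of a]
          by (intro always_eventually) (simp add: Q_def)
      qed (use defect in auto)
      then have "s \<longlonglongrightarrow> a"
        using luc_function_luc_sum[OF d] unfolding Q_def luc_function_def by blast
      from tendstoD[OF this, of "e / 2"] have "\<forall>\<^sub>F n in sequentially. norm (s n - a) < e / 2"
        using \<open>e > 0\<close> by (simp add: dist_norm)
      then obtain n where "norm (s n - a) < e / 2" by (auto simp: eventually_sequentially)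
      then show False using far[of n] by simp
    qed
    then have upper: "\<exists>r>0. \<forall>h. norm h < r \<longrightarrow> g (x + h) - g x - blinfun_apply a h \<le> e * norm h" if "e > 0" for e
      using that .
    have "(g has_derivative blinfun_apply a) (at x)"
      unfolding has_derivative_at_alt
    proof (intro conjI allI impI blinfun.bounded_linear_right)
      fix e :: real assume "e > 0"
      from upper[OF this] obtain r where r: "r > 0"
        "\<And>h. norm h < r \<Longrightarrow> g (x + h) - g x - blinfun_apply a h \<le> e * norm h" by blast
      have "norm (g y - g x - blinfun_apply a (y - x)) \<le> e * norm (y - x)" if "norm (y - x) < r" for y
        using r(2)[OF that] lower[of "y - x"] by simp
      with r(1) show "\<exists>d>0. \<forall>y. norm (y - x) < d \<longrightarrow> norm (g y - g x - blinfun_apply a (y - x)) \<le> e * norm (y - x)"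
        by blast
    qed
    then show ?thesis by (auto simp: differentiable_def)
  qed
  moreover have "convex_on UNIV g"
    unfolding g_def[abs_def] by (rule convex_on_SUP_affine[OF \<open>I \<noteq> {}\<close> bdd])
  moreover have "g x \<le> f x" for x
    unfolding g_def by (rule cSUP_least[OF \<open>I \<noteq> {}\<close>]) (rule le_f)
  moreover have "f x - \<delta> \<le> g x" for x
  proof -
    have "\<delta> / 2 > 0" using \<open>\<delta> > 0\<close> by simp
    from minorant[OF this, of x] obtain i where i: "i \<in> I" "f x - \<delta> / 2 < blinfun_apply (fst i) x + snd i" by blast
    then show ?thesis using g_ge[OF i(1), of x] QL[OF i(1)] unfolding c_def by linarith
  qed
  ultimately show ?thesis using that[of g] g_lip by blast
qed

section \<open>Smooth locally uniformly convex approximations\<close>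

text \<open>The exponent \<open>Suc n\<close> makes the weights add up to 1, so a series with these
  weights is an average and keeps common bounds and Lipschitz constants.\<close>

lemma half_powers_sums: "(\<lambda>n. (1/2::real)^Suc n * c) sums c"
  using sums_mult2[OF power_half_series, of c] by simp

lemma half_powers_tail:
  fixes a :: "nat \<Rightarrow> real"
  assumes "\<And>n. \<bar>a n\<bar> \<le> (1/2)^Suc n * c"
  shows "summable a" "\<bar>(\<Sum>i<n. a i) - suminf a\<bar> \<le> (1/2)^n * c"
proof -
  show sm: "summable a"
    by (rule summable_comparison_test'[OF sums_summable[OF half_powers_sums[of c]], of 0]) (use assms in auto)
  have tail: "(\<lambda>i. (1/2::real)^Suc (i + n) * c) sums ((1/2)^n * c)"
    using sums_mult[OF half_powers_sums[of c], of "(1/2)^n"] by (simp add: power_add mult_ac)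
  have "\<bar>\<Sum>i. a (i + n)\<bar> \<le> (\<Sum>i. (1/2::real)^Suc (i + n) * c)"
    unfolding real_norm_def[symmetric] by (rule norm_suminf_le) (use assms tail in \<open>auto dest: sums_summable\<close>)
  then show "\<bar>(\<Sum>i<n. a i) - suminf a\<bar> \<le> (1/2)^n * c"
    using suminf_split_initial_segment[OF sm, of n] sums_unique[OF tail] by simp
qed

lemma lipschitz_on_derivative_le:
  fixes g :: "'a::real_normed_vector \<Rightarrow> real"
  assumes g: "convex_on UNIV g" "L-lipschitz_on UNIV g" and l: "(g has_derivative l) (at x)"
  shows "\<bar>l h\<bar> \<le> L * norm h"
proof -
  have "l (- h) = - l h" using has_derivative_bounded_linear[OF l] by (simp add: bounded_linear.linear linear_neg)
  then show ?thesis
    using convex_on_subgradient[OF g(1) l, of "x + h"] convex_on_subgradient[OF g(1) l, of "x - h"]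
      lipschitz_onD[OF g(2), of "x + h" x] lipschitz_onD[OF g(2), of "x - h" x]
    by (simp add: dist_norm abs_le_iff)
qed

text \<open>The common Lipschitz constant bounds all derivatives by \<open>L\<close>, so the tails
  of the differentiated series are at most \<open>(1/2)^n * L\<close> uniformly in the point, which
  permits differentiation term by term.\<close>

lemma differentiable_half_powers_series:
  fixes g :: "nat \<Rightarrow> 'a::real_normed_vector \<Rightarrow> real"
  assumes g: "\<And>k. convex_on UNIV (g k)" "\<And>k. L-lipschitz_on UNIV (g k)" "\<And>k x. g k differentiable (at x)"
    and sm: "\<And>x. summable (\<lambda>k. (1/2)^Suc k * g k x)"
  shows "(\<lambda>x. \<Sum>k. (1/2)^Suc k * g k x) differentiable (at x)"
proof -
  obtain g' where g': "\<And>k x. (g k has_derivative g' k x) (at x)"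
    using g(3) unfolding differentiable_def by metis
  have L0: "L \<ge> 0" using lipschitz_on_nonneg[OF g(2)] .
  have le: "\<bar>(1/2)^Suc k * g' k y h\<bar> \<le> (1/2)^Suc k * (L * norm h)" for k y h
    using mult_left_mono[OF lipschitz_on_derivative_le[OF g(1,2) g', of k y h], of "(1/2)^Suc k"]
    by (simp add: abs_mult)
  have "\<exists>G. \<forall>x\<in>UNIV. (\<lambda>k. (1/2)^Suc k * g k x) sums G x \<and>
      (G has_derivative (\<lambda>h. \<Sum>k. (1/2)^Suc k * g' k x h)) (at x within UNIV)"
  proof (rule has_derivative_series)
    show "((\<lambda>x. (1/2)^Suc k * g k x) has_derivative (\<lambda>h. (1/2)^Suc k * g' k y h)) (at y within UNIV)" for k y
      by (intro has_derivative_mult_right g')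
    show "(\<lambda>k. (1/2)^Suc k * g k 0) sums (\<Sum>k. (1/2)^Suc k * g k 0)" by (rule summable_sums[OF sm])
    fix e :: real assume "e > 0"
    have "(\<lambda>n. (1/2::real)^n * L) \<longlonglongrightarrow> 0" by (intro tendsto_mult_left_zero LIMSEQ_power_zero) simp
    from order_tendstoD(2)[OF this \<open>e > 0\<close>]
    show "\<forall>\<^sub>F n in sequentially. \<forall>x\<in>UNIV. \<forall>h. norm ((\<Sum>i<n. (1/2)^Suc i * g' i x h) - (\<Sum>k. (1/2)^Suc k * g' k x h)) \<le> e * norm h"
    proof eventually_elim
      case (elim n)
      show ?case
      proof (intro ballI allI)
        fix y h :: 'a
        have "\<bar>(\<Sum>i<n. (1/2)^Suc i * g' i y h) - (\<Sum>k. (1/2)^Suc k * g' k y h)\<bar> \<le> (1/2)^n * (L * norm h)"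
          by (rule half_powers_tail(2)[OF le])
        also have "\<dots> \<le> e * norm h"
          using mult_right_mono[OF less_imp_le[OF elim], of "norm h"] by (simp add: mult.assoc)
        finally show "norm ((\<Sum>i<n. (1/2)^Suc i * g' i y h) - (\<Sum>k. (1/2)^Suc k * g' k y h)) \<le> e * norm h" by simp
      qed
    qed
  qed auto
  then obtain G where G: "\<And>x. (\<lambda>k. (1/2)^Suc k * g k x) sums G x"
    "(G has_derivative (\<lambda>h. \<Sum>k. (1/2)^Suc k * g' k x h)) (at x)" by auto
  have "(\<lambda>x. \<Sum>k. (1/2)^Suc k * g k x) = G" using sums_unique[OF G(1)] by auto
  with G(2) show ?thesis by (auto simp: differentiable_def)
qed

text \<open>
  A series of smoothings of one locally uniformly convex function \<open>F0\<close>, with errors tending to 0,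
  inherits local uniform convexity: the midpoint defect of each summand is dominated by that of the
  sum, and the defects of the summands approximate that of \<open>F0\<close>.
\<close>

lemma asplund_smooth_luc_approximation:
  fixes f :: "'a::banach \<Rightarrow> real"
  assumes asplund: "asplund_space TYPE('a)" and D: "countable D" "closure D = (UNIV :: 'a set)"
    and f: "convex_on UNIV f" "L-lipschitz_on UNIV f" and "\<delta> > 0"
  obtains F M where "convex_on UNIV F" "M-lipschitz_on UNIV F" "\<And>x. F differentiable (at x)" "luc_function F"
    "\<And>x. f x - \<delta> \<le> F x" "\<And>x. F x \<le> f x + \<delta> * (1 + norm x)"
proof -
  have "D \<noteq> {}" using D(2) by auto
  define d where "d = from_nat_into D"
  have "range d = D" unfolding d_def using range_from_nat_into[OF \<open>D \<noteq> {}\<close> D(1)] .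
  with D(2) have d: "closure (range d) = UNIV" by simp
  \<comment> \<open>Since \<open>luc_sum d\<close> is 2-Lipschitz and at most
    \<open>2 * (1 + norm x)\<close>, the factor \<open>\<delta> / 2\<close> adds
    \<open>\<delta>\<close> to the Lipschitz constant and at most
    \<open>\<delta> * (1 + norm x)\<close> to the values.\<close>
  define F0 where "F0 x = f x + \<delta> / 2 * luc_sum d x" for x
  define M where "M = L + \<delta>"
  have F0_convex: "convex_on UNIV F0"
    unfolding F0_def[abs_def] using \<open>\<delta> > 0\<close> by (intro convex_on_add f convex_on_cmul convex_on_luc_sum) simp
  have F0_lip: "M-lipschitz_on UNIV F0"
  proof (rule lipschitz_onI)
    show "0 \<le> M" using lipschitz_on_nonneg[OF f(2)] \<open>\<delta> > 0\<close> by (simp add: M_def)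
    fix x y
    have "\<bar>f x - f y\<bar> \<le> L * dist x y" using lipschitz_onD[OF f(2), of x y] by (simp add: dist_real_def)
    moreover have "\<delta> / 2 * \<bar>luc_sum d x - luc_sum d y\<bar> \<le> \<delta> / 2 * (2 * dist x y)"
      using lipschitz_onD[OF lipschitz_on_luc_sum, of x y d] \<open>\<delta> > 0\<close>
      by (intro mult_left_mono) (simp_all add: dist_real_def)
    moreover have "\<bar>F0 x - F0 y\<bar> \<le> \<bar>f x - f y\<bar> + \<delta> / 2 * \<bar>luc_sum d x - luc_sum d y\<bar>"
    proof -
      have "F0 x - F0 y = (f x - f y) + \<delta> / 2 * (luc_sum d x - luc_sum d y)" by (simp add: F0_def algebra_simps)
      then show ?thesis using abs_triangle_ineq[of "f x - f y" "\<delta> / 2 * (luc_sum d x - luc_sum d y)"] \<open>\<delta> > 0\<close>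
        by (simp add: abs_mult)
    qed
    ultimately show "dist (F0 x) (F0 y) \<le> M * dist x y" by (simp add: dist_real_def M_def distrib_right)
  qed
  have "\<exists>g. convex_on UNIV g \<and> M-lipschitz_on UNIV g \<and> (\<forall>x. g x \<le> F0 x) \<and> (\<forall>x. F0 x - \<delta> / real (Suc k) \<le> g x)
      \<and> (\<forall>x. g differentiable (at x))" for k
  proof -
    have "\<delta> / real (Suc k) > 0" using \<open>\<delta> > 0\<close> by simp
    then show ?thesis using asplund_smoothing[OF asplund D F0_convex F0_lip] by metis
  qed
  then obtain g where g_convex: "\<And>k. convex_on UNIV (g k)" and g_lip: "\<And>k. M-lipschitz_on UNIV (g k)"
    and g_le: "\<And>k x. g k x \<le> F0 x" and g_ge: "\<And>k x. F0 x - \<delta> / real (Suc k) \<le> g k x"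
    and g_diff: "\<And>k x. g k differentiable (at x)" by metis
  have g_ge': "F0 x - \<delta> \<le> g k x" for k x
  proof -
    have "\<delta> / real (Suc k) \<le> \<delta> / 1" using \<open>\<delta> > 0\<close> by (intro divide_left_mono) auto
    then show ?thesis using g_ge[of x k] by simp
  qed
  have sm: "summable (\<lambda>k. (1/2)^Suc k * g k x)" for x
  proof (rule half_powers_tail(1))
    fix k
    have "\<bar>g k x\<bar> \<le> \<bar>F0 x\<bar> + \<delta>" using g_le[of k x] g_ge'[of x k] by linarith
    then show "\<bar>(1/2)^Suc k * g k x\<bar> \<le> (1/2)^Suc k * (\<bar>F0 x\<bar> + \<delta>)"
      using mult_left_mono[of "\<bar>g k x\<bar>" "\<bar>F0 x\<bar> + \<delta>" "(1/2)^Suc k"] by (simp add: abs_mult)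
  qed
  define F where "F x = (\<Sum>k. (1/2)^Suc k * g k x)" for x
  have term_convex: "convex_on UNIV (\<lambda>x. (1/2)^Suc k * g k x)" for k
    by (intro convex_on_cmul g_convex) simp
  have F_convex: "convex_on UNIV F"
    unfolding F_def[abs_def] by (rule convex_on_suminf[OF term_convex sm])
  have F_le: "F x \<le> F0 x" for x
    unfolding F_def by (subst sums_unique[OF half_powers_sums[of "F0 x"]])
      (intro suminf_le sm sums_summable[OF half_powers_sums] mult_left_mono g_le; simp)
  have F_ge: "F0 x - \<delta> \<le> F x" for x
    unfolding F_def by (subst sums_unique[OF half_powers_sums[of "F0 x - \<delta>"]])
      (intro suminf_le sm sums_summable[OF half_powers_sums] mult_left_mono g_ge'; simp)
  have F_lip: "M-lipschitz_on UNIV F"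
  proof (rule lipschitz_onI)
    show "0 \<le> M" using lipschitz_on_nonneg[OF F0_lip] .
    have *: "F x - F y \<le> M * dist x y" for x y
      unfolding F_def suminf_diff[OF sm sm]
    proof (subst sums_unique[OF half_powers_sums[of "M * dist x y"]], intro suminf_le summable_diff sm sums_summable[OF half_powers_sums])
      fix k
      have "g k x - g k y \<le> M * dist x y" using lipschitz_onD[OF g_lip, of x y k] by (simp add: dist_real_def)
      from mult_left_mono[OF this, of "(1/2)^Suc k"]
      show "(1/2)^Suc k * g k x - (1/2)^Suc k * g k y \<le> (1/2)^Suc k * (M * dist x y)"
        by (simp add: right_diff_distrib)
    qed
    show "dist (F x) (F y) \<le> M * dist x y" for x y
      using *[of x y] *[of y x] unfolding dist_real_def dist_commute[of y] by linarith
  qed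
  have F_diff: "F differentiable (at x)" for x
    unfolding F_def[abs_def] by (rule differentiable_half_powers_series[OF g_convex g_lip g_diff sm])
  have "luc_function F"
    unfolding luc_function_def
  proof (intro allI impI)
    fix x :: 'a and xs :: "nat \<Rightarrow> 'a"
    define \<Delta> where "\<Delta> u n = u x + u (xs n) - 2 * u ((1/2) *\<^sub>R (x + xs n))" for u :: "'a \<Rightarrow> real" and n
    assume "(\<lambda>n. F x + F (xs n) - 2 * F ((1/2) *\<^sub>R (x + xs n))) \<longlonglongrightarrow> 0"
    then have lim: "\<Delta> F \<longlonglongrightarrow> 0" by (simp add: \<Delta>_def[abs_def])
    have \<Delta>0: "0 \<le> \<Delta> u n" if "convex_on UNIV u" for u n
      using convex_on_midpoint[OF that, of x "xs n"] by (simp add: \<Delta>_def)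
    have \<Delta>g: "(1/2)^Suc k * \<Delta> (g k) n \<le> \<Delta> F n" for k n
    proof -
      have eq: "(\<lambda>k. (1/2)^Suc k * \<Delta> (g k) n) sums \<Delta> F n"
      proof -
        have "(\<lambda>k. (1/2)^Suc k * g k x + (1/2)^Suc k * g k (xs n) - 2 * ((1/2)^Suc k * g k ((1/2) *\<^sub>R (x + xs n))))
            sums \<Delta> F n"
          unfolding \<Delta>_def F_def by (intro sums_diff sums_add sums_mult summable_sums sm)
        moreover have "(1/2)^Suc k * \<Delta> (g k) n = (1/2)^Suc k * g k x + (1/2)^Suc k * g k (xs n)
            - 2 * ((1/2)^Suc k * g k ((1/2) *\<^sub>R (x + xs n)))" for k
          by (simp add: \<Delta>_def right_diff_distrib distrib_left)
        ultimately show ?thesis by (simp only:)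
      qed
      have "(\<Sum>i\<in>{k}. (1/2)^Suc i * \<Delta> (g i) n) \<le> (\<Sum>k. (1/2)^Suc k * \<Delta> (g k) n)"
        by (intro sum_le_suminf sums_summable[OF eq] mult_nonneg_nonneg \<Delta>0 g_convex) auto
      then show ?thesis using sums_unique[OF eq] by simp
    qed
    have "\<Delta> (luc_sum d) \<longlonglongrightarrow> 0"
    proof (rule tendstoI)
      fix e :: real assume "e > 0"
      \<comment> \<open>The target for the defect of \<open>F0\<close>, which contains that of
        \<open>luc_sum d\<close> with factor \<open>\<delta> / 2\<close>. One half goes to the
        smoothing error of a fixed \<open>g k\<close>, the other to the defect of that
        \<open>g k\<close>.\<close>
      define e' where "e' = e * \<delta> / 2"
      have "e' > 0" using \<open>e > 0\<close> \<open>\<delta> > 0\<close> by (simp add: e'_def)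
      have "0 < e' / (4 * \<delta>)" using \<open>e' > 0\<close> \<open>\<delta> > 0\<close> by simp
      then obtain k where k: "1 / real (Suc k) < e' / (4 * \<delta>)" by (rule nat_approx_posE)
      from mult_strict_left_mono[OF this \<open>\<delta> > 0\<close>] have k': "2 * (\<delta> / real (Suc k)) < e' / 2"
        using \<open>\<delta> > 0\<close> by (simp add: mult.commute)
      have "0 < (1/2)^Suc k * (e' / 2)" using \<open>e' > 0\<close> by simp
      from order_tendstoD(2)[OF lim this]
      show "\<forall>\<^sub>F n in sequentially. dist (\<Delta> (luc_sum d) n) 0 < e"
      proof eventually_elim
        case (elim n)
        have "(1/2)^Suc k * \<Delta> (g k) n < (1/2)^Suc k * (e' / 2)" using \<Delta>g[of k n] elim by linarith
        then have "\<Delta> (g k) n < e' / 2" by (rule mult_left_less_imp_less) simp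
        \<comment> \<open>The smoothing error enters at the two end points only; at the midpoint
          \<open>g k \<le> F0\<close> has the favourable sign.\<close>
        moreover have "\<Delta> F0 n \<le> \<Delta> (g k) n + 2 * (\<delta> / real (Suc k))"
          using g_ge[of x k] g_ge[of "xs n" k] g_le[of k "(1/2) *\<^sub>R (x + xs n)"] unfolding \<Delta>_def by linarith
        moreover have "\<Delta> F0 n = \<Delta> f n + \<delta> / 2 * \<Delta> (luc_sum d) n" by (simp add: \<Delta>_def F0_def algebra_simps)
        ultimately have "\<delta> / 2 * \<Delta> (luc_sum d) n < e'" using \<Delta>0[OF f(1), of n] k' by linarith
        then have "\<Delta> (luc_sum d) n < e" using \<open>\<delta> > 0\<close> by (simp add: e'_def)
        then show ?case using \<Delta>0[OF convex_on_luc_sum, of d n] by simp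
      qed
    qed
    then show "xs \<longlonglongrightarrow> x" using luc_function_luc_sum[OF d] unfolding luc_function_def \<Delta>_def[abs_def] by simp
  qed
  moreover have "f x - \<delta> \<le> F x" "F x \<le> f x + \<delta> * (1 + norm x)" for x
  proof -
    have "0 \<le> \<delta> / 2 * luc_sum d x" using luc_sum_nonneg[of d x] \<open>\<delta> > 0\<close> by simp
    then show "f x - \<delta> \<le> F x" using F_ge[of x] by (simp add: F0_def)
    have "\<delta> / 2 * luc_sum d x \<le> \<delta> / 2 * (2 * (1 + norm x))"
      using luc_sum_le[of d x] \<open>\<delta> > 0\<close> by (intro mult_left_mono) auto
    also have "\<dots> = \<delta> * (1 + norm x)" by simp
    finally show "F x \<le> f x + \<delta> * (1 + norm x)" using F_le[of x] unfolding F0_def by linarith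
  qed
  ultimately show ?thesis using that F_convex F_lip F_diff by blast
qed

section \<open>Gauges of sublevel sets\<close>

lemma minkowski_functional_le:
  assumes "t > 0" "(1 / t) *\<^sub>R x \<in> C"
  shows "minkowski_functional C x \<le> t"
proof -
  have "x = t *\<^sub>R ((1 / t) *\<^sub>R x)" using assms(1) by simp
  then have "x \<in> (\<lambda>y. t *\<^sub>R y) ` C" using assms(2) by (rule image_eqI)
  then show ?thesis
    unfolding minkowski_functional_def using assms(1) by (intro cInf_lower bdd_belowI[of _ 0]) auto
qed

text \<open>The witness \<open>t0\<close> guarantees that the infimum is taken over a nonempty
  set.\<close>

lemma minkowski_functional_ge:
  assumes "t0 > 0" "(1 / t0) *\<^sub>R x \<in> C" and le: "\<And>s. s > 0 \<Longrightarrow> (1 / s) *\<^sub>R x \<in> C \<Longrightarrow> t \<le> s"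
  shows "t \<le> minkowski_functional C x"
  unfolding minkowski_functional_def
proof (rule cInf_greatest)
  have "x = t0 *\<^sub>R ((1 / t0) *\<^sub>R x)" using assms(1) by simp
  then have "x \<in> (*\<^sub>R) t0 ` C" using assms(2) by (rule image_eqI)
  then show "{t. 0 < t \<and> x \<in> (*\<^sub>R) t ` C} \<noteq> {}" using assms(1) by auto
  show "t \<le> s" if "s \<in> {t. 0 < t \<and> x \<in> (*\<^sub>R) t ` C}" for s
    using that by (intro le) auto
qed

text \<open>The setting after an interior point of the body has been moved to the origin. The gauge
  is accessible through the sign of \<open>G (x / t) - \<eta>\<close>: a value at most 0 bounds it
  above by \<open>t\<close>, a value at least 0 bounds it below.\<close>

locale convex_sublevel =
  fixes G :: "'a::real_normed_vector \<Rightarrow> real" and L \<eta> :: real and C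
  assumes convex: "convex_on UNIV G" and lip: "L-lipschitz_on UNIV G" and G0: "G 0 < \<eta>"
    and C: "C = {x. G x \<le> \<eta>}" and bounded: "bounded C"
begin

lemma L0: "0 \<le> L" using lip by (rule lipschitz_on_nonneg)

lemma continuous: "continuous_on S G"
  using lipschitz_on_continuous_on[OF lip] by (rule continuous_on_subset) simp

lemma absorbing: "\<exists>t>0. (1 / t) *\<^sub>R x \<in> C"
proof -
  \<comment> \<open>Makes the Lipschitz bound \<open>L * norm x / t\<close> at most
    \<open>\<eta> - G 0\<close>; the summand 1 keeps \<open>t\<close> positive.\<close>
  define t where "t = (L * norm x + 1) / (\<eta> - G 0)"
  have "L * norm x \<ge> 0" using L0 by simp
  then have "t > 0" using G0 by (simp add: t_def)
  have "G ((1 / t) *\<^sub>R x) - G 0 \<le> L * norm ((1 / t) *\<^sub>R x)"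
    using lipschitz_onD[OF lip, of "(1 / t) *\<^sub>R x" 0] by (simp add: dist_norm)
  also have "\<dots> = L * norm x / t" using \<open>t > 0\<close> by simp
  also have "\<dots> \<le> \<eta> - G 0"
  proof -
    have "t * (\<eta> - G 0) = L * norm x + 1" using G0 by (simp add: t_def)
    then show ?thesis using \<open>t > 0\<close> by (simp add: pos_divide_le_eq mult.commute)
  qed
  finally have "(1 / t) *\<^sub>R x \<in> C" by (simp add: C)
  with \<open>t > 0\<close> show ?thesis by blast
qed

lemma gauge_le: "t > 0 \<Longrightarrow> G ((1 / t) *\<^sub>R x) \<le> \<eta> \<Longrightarrow> minkowski_functional C x \<le> t"
  by (rule minkowski_functional_le) (auto simp: C)

text \<open>If \<open>x / s\<close> were in \<open>C\<close> for some \<open>s < t\<close>, then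
  \<open>x / t\<close> would lie strictly between 0 and \<open>x / s\<close> or coincide with both,
  and convexity with \<open>G 0 < \<eta>\<close> would give
  \<open>G (x / t) < \<eta>\<close>.\<close>

lemma gauge_ge:
  assumes "t > 0" "\<eta> \<le> G ((1 / t) *\<^sub>R x)"
  shows "t \<le> minkowski_functional C x"
proof -
  obtain t0 where t0: "t0 > 0" "(1 / t0) *\<^sub>R x \<in> C" using absorbing by blast
  show ?thesis
  proof (rule minkowski_functional_ge[OF t0])
    fix s assume s: "s > 0" "(1 / s) *\<^sub>R x \<in> C"
    show "t \<le> s"
    proof (rule ccontr)
      assume "\<not> t \<le> s"
      then have r: "0 < s / t" "s / t < 1" using s(1) \<open>t > 0\<close> by auto
      have "(1 / t) *\<^sub>R x = (1 - s / t) *\<^sub>R 0 + (s / t) *\<^sub>R ((1 / s) *\<^sub>R x)" using s(1) by simp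
      then have "G ((1 / t) *\<^sub>R x) \<le> (1 - s / t) * G 0 + (s / t) * G ((1 / s) *\<^sub>R x)"
        using convex_onD[OF convex, of "s / t" 0 "(1 / s) *\<^sub>R x"] r by (simp only: less_imp_le UNIV_I)
      also have "\<dots> \<le> (1 - s / t) * G 0 + (s / t) * \<eta>"
        using s r by (intro add_left_mono mult_left_mono) (auto simp: C)
      also have "\<dots> < (1 - s / t) * \<eta> + (s / t) * \<eta>"
        using G0 r by (intro add_strict_right_mono mult_strict_left_mono) auto
      also have "\<dots> = \<eta>" by (simp add: algebra_simps)
      finally show False using assms(2) by simp
    qed
  qed
qed

lemma boundary_point:
  assumes "x \<noteq> 0"
  obtains t where "t > 0" "G ((1 / t) *\<^sub>R x) = \<eta>"
proof -
  obtain R where R: "\<And>y. y \<in> C \<Longrightarrow> norm y \<le> R" using bounded by (auto simp: bounded_iff)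
  define b where "b = (\<bar>R\<bar> + 1) / norm x"
  have "b > 0" using assms by (simp add: b_def)
  have "norm (b *\<^sub>R x) = \<bar>R\<bar> + 1" using assms by (simp add: b_def)
  then have "b *\<^sub>R x \<notin> C" using R[of "b *\<^sub>R x"] by auto
  then have "\<eta> \<le> G (b *\<^sub>R x)" by (simp add: C)
  moreover have "continuous_on {0..b} (\<lambda>t. G (t *\<^sub>R x))"
    by (rule continuous_on_compose2[OF continuous[of UNIV]]) (auto intro!: continuous_intros)
  ultimately obtain s where s: "0 \<le> s" "s \<le> b" "G (s *\<^sub>R x) = \<eta>"
    using IVT'[of "\<lambda>t. G (t *\<^sub>R x)" 0 \<eta> b] G0 \<open>b > 0\<close> by auto
  then have "s > 0" using G0 by (cases "s = 0") auto
  then show ?thesis using that[of "1 / s"] s by simp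
qed

text \<open>Implicit differentiation of \<open>G (x / p x) = \<eta>\<close>. The derivative should
  be \<open>l h / m\<close> with \<open>m\<close> the radial derivative at
  \<open>u = x / t0\<close>. The trial values \<open>t0 + l h / m + e * norm h\<close> and
  \<open>t0 + l h / m - e * norm h\<close> put \<open>G\<close> on opposite sides of
  \<open>\<eta>\<close>, and this traps \<open>p (x + h)\<close> between them.\<close>

lemma frechet_smooth:
  assumes diff: "\<And>x. G differentiable (at x)"
  shows "frechet_smooth_origin C"
  unfolding frechet_smooth_origin_def
proof (intro allI impI)
  fix x :: 'a assume "x \<noteq> 0"
  then obtain t0 where t0: "t0 > 0" "G ((1 / t0) *\<^sub>R x) = \<eta>" using boundary_point by metis
  define p where "p = minkowski_functional C"
  have px: "p x = t0" using gauge_le[of t0 x] gauge_ge[of t0 x] t0 by (simp add: p_def)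
  define u where "u = (1 / t0) *\<^sub>R x"
  have x: "x = t0 *\<^sub>R u" using t0 by (simp add: u_def)
  have Gu: "G u = \<eta>" using t0 by (simp add: u_def)
  obtain l where l: "(G has_derivative l) (at u)" using diff by (auto simp: differentiable_def)
  have bl: "bounded_linear l" using l by (rule has_derivative_bounded_linear)
  then have lin: "linear l" by (rule bounded_linear.linear)
  define m where "m = l u"
  \<comment> \<open>The subgradient inequality at \<open>u\<close>, evaluated at 0, gives
    \<open>m \<ge> \<eta> - G 0\<close>.\<close>
  have "m > 0"
    using convex_on_subgradient[OF convex l, of 0] G0 Gu linear_neg[OF lin, of u] by (simp add: m_def)
  obtain K' where K': "\<And>h. norm (l h) \<le> norm h * K'" using bounded_linear.bounded[OF bl] by blast
  define K where "K = \<bar>K'\<bar> / m"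
  have "K \<ge> 0" using \<open>m > 0\<close> by (simp add: K_def)
  have K: "\<bar>l h / m\<bar> \<le> K * norm h" for h
  proof -
    have "\<bar>l h\<bar> \<le> \<bar>K'\<bar> * norm h" using K'[of h] mult_left_mono[OF abs_ge_self[of K'], of "norm h"] by (simp add: mult.commute)
    then show ?thesis using \<open>m > 0\<close> by (simp add: K_def abs_divide divide_right_mono)
  qed
  have "(p has_derivative (\<lambda>h. l h / m)) (at x)"
    unfolding has_derivative_at_alt
  proof (intro conjI allI impI)
    show "bounded_linear (\<lambda>h. l h / m)" by (intro bounded_linear_divide bounded_linear_compose[OF _ bl, of "\<lambda>y. y / m"] bounded_linear_ident)
    fix e :: real assume "e > 0"
    \<comment> \<open>Bounds \<open>norm (h - a u)\<close> by \<open>N * norm h\<close> for the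
      trial increments \<open>a\<close>; asking for precision \<open>e * m / N\<close> at
      \<open>u\<close> makes the error exactly as large as the shift caused by
      \<open>e * norm h\<close>.\<close>
    define N where "N = 1 + (K + e) * norm u"
    have "N > 0" using \<open>K \<ge> 0\<close> \<open>e > 0\<close> by (simp add: N_def add_pos_nonneg)
    have "e * m / N > 0" using \<open>e > 0\<close> \<open>m > 0\<close> \<open>N > 0\<close> by simp
    then obtain d where "d > 0"
      and d: "\<And>y. norm (y - u) < d \<Longrightarrow> norm (G y - G u - l (y - u)) \<le> e * m / N * norm (y - u)"
      using l unfolding has_derivative_at_alt by (elim conjE allE[of _ "e * m / N"]) auto
    \<comment> \<open>The first term keeps \<open>t0 + a\<close> above \<open>t0 / 2\<close>, the
      second keeps the rescaled point within \<open>d\<close> of \<open>u\<close>.\<close>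
    define r where "r = min (t0 / (2 * (K + e))) (d * t0 / (2 * N))"
    have "r > 0" using t0 \<open>K \<ge> 0\<close> \<open>e > 0\<close> \<open>d > 0\<close> \<open>N > 0\<close> by (simp add: r_def)
    have step: "\<bar>G ((1 / (t0 + a)) *\<^sub>R (x + h)) - \<eta> - (l h - a * m) / (t0 + a)\<bar> \<le> e * m * norm h / (t0 + a) \<and> t0 + a > 0"
      if h: "norm h < r" and a: "\<bar>a\<bar> \<le> (K + e) * norm h" for h a
    proof -
      have "(K + e) * norm h \<le> (K + e) * (t0 / (2 * (K + e)))"
        using h \<open>K \<ge> 0\<close> \<open>e > 0\<close> by (intro mult_left_mono) (auto simp: r_def)
      also have "\<dots> = t0 / 2" using \<open>K \<ge> 0\<close> \<open>e > 0\<close> by (simp add: field_simps)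
      finally have "t0 / 2 \<le> t0 + a" using a by linarith
      define t where "t = t0 + a"
      have t: "t0 / 2 \<le> t" "t > 0" using \<open>t0 / 2 \<le> t0 + a\<close> t0 by (auto simp: t_def)
      define y where "y = (1 / t) *\<^sub>R (x + h)"
      have "t *\<^sub>R y = x + h" using t by (simp add: y_def)
      then have "t *\<^sub>R (y - u) = h - a *\<^sub>R u" by (simp add: x t_def algebra_simps)
      from this[symmetric] have yu: "y - u = (1 / t) *\<^sub>R (h - a *\<^sub>R u)" using t by simp
      have "norm (h - a *\<^sub>R u) \<le> norm h + \<bar>a\<bar> * norm u" using norm_triangle_ineq4[of h "a *\<^sub>R u"] by simp
      also have "\<dots> \<le> norm h + (K + e) * norm h * norm u" using a by (intro add_left_mono mult_right_mono) auto
      finally have nh: "norm (h - a *\<^sub>R u) \<le> N * norm h" by (simp add: N_def algebra_simps)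
      then have nyu: "norm (y - u) \<le> N * norm h / t" using t by (simp add: yu divide_right_mono)
      also have "\<dots> \<le> N * norm h / (t0 / 2)" using t t0 \<open>N > 0\<close> by (intro divide_left_mono) auto
      also have "\<dots> < d"
      proof -
        have "norm h < d * t0 / (2 * N)" using h by (simp add: r_def)
        then show ?thesis using \<open>N > 0\<close> t0 by (simp add: field_simps)
      qed
      finally have "\<bar>G y - \<eta> - l (y - u)\<bar> \<le> e * m / N * norm (y - u)" using d[of y] Gu by simp
      also have "\<dots> \<le> e * m / N * (N * norm h / t)"
        using nyu \<open>e * m / N > 0\<close> by (intro mult_left_mono) auto
      also have "\<dots> = e * m * norm h / t" using \<open>N > 0\<close> by simp
      finally have *: "\<bar>G y - \<eta> - l (y - u)\<bar> \<le> e * m * norm h / t" .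
      have "l (y - u) = (l h - a * m) / t"
        unfolding yu by (simp add: linear_cmul[OF lin] linear_diff[OF lin] m_def)
      with * t show ?thesis by (simp add: t_def[symmetric] y_def)
    qed
    have "\<bar>p (x + h) - p x - l h / m\<bar> \<le> e * norm h" if h: "norm h < r" for h
    proof -
      have a: "\<bar>l h / m + e * norm h\<bar> \<le> (K + e) * norm h" "\<bar>l h / m - e * norm h\<bar> \<le> (K + e) * norm h"
        using K[of h] mult_nonneg_nonneg[OF less_imp_le[OF \<open>e > 0\<close>] norm_ge_zero[of h]] unfolding distrib_right by linarith+
      have ab: "\<bar>v - \<eta> - - w\<bar> \<le> w \<Longrightarrow> v \<le> \<eta>" "\<bar>v - \<eta> - w\<bar> \<le> w \<Longrightarrow> \<eta> \<le> v" for v w :: real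
        by linarith+
      note s = step[OF h a(1)] step[OF h a(2)]
      have 1: "l h - (l h / m + e * norm h) * m = - (e * m * norm h)" using \<open>m > 0\<close> by (simp add: field_simps)
      have 2: "l h - (l h / m - e * norm h) * m = e * m * norm h" using \<open>m > 0\<close> by (simp add: field_simps)
      have "p (x + h) \<le> t0 + (l h / m + e * norm h)"
        unfolding p_def using s(1) ab(1) unfolding 1 minus_divide_left[symmetric] by (intro gauge_le) blast+
      moreover have "t0 + (l h / m - e * norm h) \<le> p (x + h)"
        unfolding p_def using s(2) ab(2) unfolding 2 by (intro gauge_ge) blast+
      ultimately show ?thesis unfolding px by linarith
    qed
    from this[of "y - x" for y] have "norm (p y - p x - l (y - x) / m) \<le> e * norm (y - x)" if "norm (y - x) < r" for y
      using that by simp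
    then show "\<exists>d>0. \<forall>y. norm (y - x) < d \<longrightarrow> norm (p y - p x - l (y - x) / m) \<le> e * norm (y - x)"
      using \<open>r > 0\<close> by blast
  qed
  then show "minkowski_functional C differentiable (at x)" by (auto simp: differentiable_def p_def)
qed

lemma frontier_level: "x \<in> frontier C \<Longrightarrow> G x = \<eta>"
proof -
  assume x: "x \<in> frontier C"
  have "closed C" unfolding C by (intro closed_Collect_le continuous continuous_on_const)
  then have "x \<in> C" using x by (simp add: frontier_def)
  moreover have "\<not> G x < \<eta>"
  proof
    assume "G x < \<eta>"
    moreover have "open {x. G x < \<eta>}" by (intro open_Collect_less continuous continuous_on_const)
    ultimately have "x \<in> interior C" by (intro interiorI[of "{x. G x < \<eta>}"]) (auto simp: C)
    then show False using x by (simp add: frontier_def)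
  qed
  ultimately show ?thesis by (simp add: C)
qed

text \<open>Both points satisfy \<open>G = \<eta>\<close>, so the midpoint defect is
  \<open>2 * (\<eta> - G mid)\<close>. If the gauge of \<open>x + xs n\<close> exceeds
  \<open>t = 2 - \<tau>\<close>, then \<open>G\<close> is at least \<open>\<eta>\<close> at
  \<open>(x + xs n) / t\<close>, and the Lipschitz bound carries this to the nearby
  midpoint.\<close>

lemma locally_uniformly_convex:
  assumes "luc_function G"
  shows "locally_uniformly_convex_origin C"
  unfolding locally_uniformly_convex_origin_def
proof (intro ballI allI impI)
  fix x and xs :: "nat \<Rightarrow> 'a"
  assume x: "x \<in> frontier C" and xs: "\<forall>n. xs n \<in> frontier C"
    and lim: "(\<lambda>n. minkowski_functional C (x + xs n)) \<longlonglongrightarrow> 2"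
  have Gx: "G x = \<eta>" "G (xs n) = \<eta>" for n using frontier_level x xs by auto
  obtain R where R: "\<And>y. y \<in> C \<Longrightarrow> norm y \<le> R" using bounded by (auto simp: bounded_iff)
  have nR: "norm (x + xs n) \<le> 2 * R" for n
    using R[of x] R[of "xs n"] Gx norm_triangle_ineq[of x "xs n"] by (simp add: C)
  have "R \<ge> 0" using nR[of 0] norm_ge_zero[of "x + xs 0"] by linarith
  have mid: "G ((1/2) *\<^sub>R (x + xs n)) \<le> \<eta>" for n
    using convex_on_midpoint[OF convex, of x "xs n"] Gx by simp
  have "(\<lambda>n. G x + G (xs n) - 2 * G ((1/2) *\<^sub>R (x + xs n))) \<longlonglongrightarrow> 0"
  proof (rule tendstoI)
    fix e :: real assume "e > 0"
    \<comment> \<open>The cap 1 keeps \<open>2 - \<tau>\<close> at least 1; the second term makes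
      the defect bound \<open>2 * (L * R * \<tau>)\<close> smaller than \<open>e\<close>, also when
      \<open>L * R = 0\<close>.\<close>
    define \<tau> where "\<tau> = min 1 (e / (2 * (L * R + 1)))"
    have LR: "L * R \<ge> 0" using L0 \<open>R \<ge> 0\<close> by simp
    then have \<tau>: "0 < \<tau>" "\<tau> \<le> 1" "2 * (L * R * \<tau>) < e"
    proof -
      show "0 < \<tau>" "\<tau> \<le> 1" using LR \<open>e > 0\<close> by (auto simp: \<tau>_def)
      have "2 * ((L * R + 1) * \<tau>) \<le> 2 * ((L * R + 1) * (e / (2 * (L * R + 1))))"
        using LR by (intro mult_left_mono) (auto simp: \<tau>_def)
      also have "\<dots> = e" using LR by (simp add: field_simps)
      finally show "2 * (L * R * \<tau>) < e" using \<open>0 < \<tau>\<close> by (simp add: distrib_right)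
    qed
    have "\<forall>\<^sub>F n in sequentially. 2 - \<tau> < minkowski_functional C (x + xs n)"
      using \<tau> by (intro order_tendstoD(1)[OF lim]) simp
    then show "\<forall>\<^sub>F n in sequentially. dist (G x + G (xs n) - 2 * G ((1/2) *\<^sub>R (x + xs n))) 0 < e"
    proof eventually_elim
      case (elim n)
      define t where "t = 2 - \<tau>"
      have t: "t > 0" "1 \<le> t" using \<tau> by (auto simp: t_def)
      have 1: "\<eta> \<le> G ((1 / t) *\<^sub>R (x + xs n))" using gauge_le[OF t(1), of "x + xs n"] elim unfolding t_def by linarith
      have "1 / t - 1 / 2 = \<tau> / (2 * t)" using t by (simp add: t_def field_simps)
      then have 2: "0 \<le> 1 / t - 1 / 2" "1 / t - 1 / 2 \<le> \<tau> / 2"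
        using t \<tau> by (auto simp: divide_simps)
      have "G ((1 / t) *\<^sub>R (x + xs n)) - G ((1 / 2) *\<^sub>R (x + xs n)) \<le> L * norm ((1 / t - 1 / 2) *\<^sub>R (x + xs n))"
        using lipschitz_onD[OF lip, of "(1 / t) *\<^sub>R (x + xs n)" "(1 / 2) *\<^sub>R (x + xs n)"]
        by (simp add: dist_norm abs_le_iff flip: scaleR_diff_left)
      also have "\<dots> \<le> L * (\<tau> / 2 * (2 * R))"
        unfolding norm_scaleR using 2 nR[of n] L0 \<tau> by (intro mult_left_mono mult_mono) auto
      finally have "\<eta> - G ((1/2) *\<^sub>R (x + xs n)) \<le> L * R * \<tau>" using 1 by (simp add: mult_ac)
      then show ?case using \<tau>(3) mid[of n] Gx by simp
    qed
  qed
  then show "xs \<longlonglongrightarrow> x" using assms unfolding luc_function_def by blast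
qed

end

section \<open>Approximation of convex bodies\<close>

lemma infdist_lessE:
  assumes "B \<noteq> {}" "infdist x B < r"
  obtains b where "b \<in> B" "dist x b < r"
  using assms cInf_lessD[of "dist x ` B" r] by (auto simp: infdist_notempty)

lemma convex_on_infdist:
  fixes B :: "'a::real_normed_vector set"
  assumes "convex B" "B \<noteq> {}"
  shows "convex_on UNIV (\<lambda>x. infdist x B)"
proof
  fix t :: real and x y :: 'a assume t: "0 < t" "t < 1"
  show "infdist ((1 - t) *\<^sub>R x + t *\<^sub>R y) B \<le> (1 - t) * infdist x B + t * infdist y B"
  proof (rule field_le_epsilon)
    fix e :: real assume "e > 0"
    obtain a where a: "a \<in> B" "dist x a < infdist x B + e" using infdist_lessE[OF assms(2), of x "infdist x B + e"] \<open>e > 0\<close> by auto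
    obtain b where b: "b \<in> B" "dist y b < infdist y B + e" using infdist_lessE[OF assms(2), of y "infdist y B + e"] \<open>e > 0\<close> by auto
    have "(1 - t) *\<^sub>R a + t *\<^sub>R b \<in> B" using convexD_alt[OF assms(1) a(1) b(1), of t] t by simp
    then have "infdist ((1 - t) *\<^sub>R x + t *\<^sub>R y) B \<le> norm (((1 - t) *\<^sub>R x + t *\<^sub>R y) - ((1 - t) *\<^sub>R a + t *\<^sub>R b))"
      unfolding dist_norm[symmetric] by (rule infdist_le)
    also have "((1 - t) *\<^sub>R x + t *\<^sub>R y) - ((1 - t) *\<^sub>R a + t *\<^sub>R b) = (1 - t) *\<^sub>R (x - a) + t *\<^sub>R (y - b)"
      by (simp add: algebra_simps)
    also have "norm \<dots> \<le> (1 - t) * dist x a + t * dist y b"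
      using norm_triangle_ineq[of "(1 - t) *\<^sub>R (x - a)" "t *\<^sub>R (y - b)"] t by (simp add: dist_norm)
    also have "\<dots> \<le> (1 - t) * (infdist x B + e) + t * (infdist y B + e)"
      using a b t by (intro add_mono mult_left_mono) auto
    also have "\<dots> = (1 - t) * infdist x B + t * infdist y B + e" by (simp add: algebra_simps)
    finally show "infdist ((1 - t) *\<^sub>R x + t *\<^sub>R y) B \<le> (1 - t) * infdist x B + t * infdist y B + e" .
  qed
qed simp

lemma hausdorff_dist_le:
  assumes "r > 0" "\<And>a. a \<in> A \<Longrightarrow> \<exists>b\<in>B. dist a b \<le> r" "\<And>b. b \<in> B \<Longrightarrow> \<exists>a\<in>A. dist b a \<le> r"
  shows "hausdorff_dist A B \<le> r"
proof -
  have *: "S \<subseteq> closure {b + r *\<^sub>R u | b u. b \<in> T \<and> u \<in> cball 0 1}"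
    if ST: "\<And>a. a \<in> S \<Longrightarrow> \<exists>b\<in>T. dist a b \<le> r" for S T :: "'a set"
  proof (rule subset_trans[OF _ closure_subset], rule subsetI)
    fix a assume "a \<in> S"
    then obtain b where b: "b \<in> T" "dist a b \<le> r" using ST by blast
    have "a = b + r *\<^sub>R ((1 / r) *\<^sub>R (a - b))" using \<open>r > 0\<close> by simp
    moreover have "(1 / r) *\<^sub>R (a - b) \<in> cball 0 1" using b \<open>r > 0\<close> by (simp add: dist_norm)
    ultimately show "a \<in> {b + r *\<^sub>R u | b u. b \<in> T \<and> u \<in> cball 0 1}" using b(1) by blast
  qed
  show ?thesis
    unfolding hausdorff_dist_def
    by (rule cInf_lower) (use assms * in \<open>auto intro!: bdd_belowI[of _ 0]\<close>)
qed

text \<open>The body is the set where \<open>F \<le> \<epsilon> / 4\<close>, with \<open>F\<close>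
  close to the distance from \<open>B\<close>. It contains \<open>B\<close>, and its points are
  closer than \<open>\<epsilon> / 2\<close> to \<open>B\<close>. Every point of \<open>B\<close> is
  interior to it and may serve as its centre.\<close>

lemma asplund_approximation:
  fixes B :: "'a::banach set"
  assumes asplund: "asplund_space TYPE('a)" and D: "countable D" "closure D = (UNIV :: 'a set)"
    and B: "convex_body B" and "\<epsilon> > 0"
  shows "\<exists>C. convex_body C \<and> locally_uniformly_convex_body C \<and> frechet_smooth_body C \<and> hausdorff_dist B C < \<epsilon>"
proof -
  have "convex B" "bounded B" using B by (auto simp: convex_body_def)
  have "B \<noteq> {}" using B by (auto simp: convex_body_def)
  then obtain x0 where x0: "x0 \<in> B" by blast
  obtain R where R: "R > 0" "\<And>b. b \<in> B \<Longrightarrow> norm b \<le> R" using \<open>bounded B\<close> by (auto simp: bounded_pos)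
  \<comment> \<open>On \<open>B\<close> the error \<open>\<delta> * (1 + norm b)\<close> is at most
    \<open>\<epsilon> / 8\<close>, so \<open>F < \<eta>\<close> there. On \<open>C\<close> the
    distance to \<open>B\<close> is at most \<open>\<eta> + \<delta>\<close>, which is below
    \<open>\<epsilon> / 2\<close>.\<close>
  define \<delta> where "\<delta> = \<epsilon> / (8 * (1 + R))"
  have "\<delta> > 0" using \<open>\<epsilon> > 0\<close> R by (simp add: \<delta>_def)
  have \<delta>R: "\<delta> * (1 + R) = \<epsilon> / 8" using R(1) by (simp add: \<delta>_def) (simp add: field_simps)
  have "\<delta> < \<epsilon> / 8" using mult_strict_left_mono[of 1 "1 + R", OF _ \<open>\<delta> > 0\<close>] R \<delta>R by simp
  have lip: "1-lipschitz_on UNIV (\<lambda>x. infdist x B)"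
    by (rule lipschitz_onI) (auto simp: dist_real_def infdist_triangle_abs)
  obtain F M where F: "convex_on UNIV F" "M-lipschitz_on UNIV F" "\<And>x. F differentiable (at x)" "luc_function F"
    "\<And>x. infdist x B - \<delta> \<le> F x" "\<And>x. F x \<le> infdist x B + \<delta> * (1 + norm x)"
    using asplund_smooth_luc_approximation[OF asplund D convex_on_infdist[OF \<open>convex B\<close> \<open>B \<noteq> {}\<close>] lip \<open>\<delta> > 0\<close>] by metis
  define \<eta> where "\<eta> = \<epsilon> / 4"
  define C where "C = {x. F x \<le> \<eta>}"
  have F_B: "F b < \<eta>" if "b \<in> B" for b
  proof -
    have "\<delta> * (1 + norm b) \<le> \<delta> * (1 + R)" using R(2)[OF that] \<open>\<delta> > 0\<close> by (intro mult_left_mono) auto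
    then show ?thesis using F(6)[of b] that \<delta>R \<open>\<epsilon> > 0\<close> by (simp add: \<eta>_def)
  qed
  have C_near: "\<exists>b\<in>B. dist x b \<le> \<epsilon> / 2" if "x \<in> C" for x
  proof -
    have "infdist x B < \<epsilon> / 2" using F(5)[of x] that \<open>\<delta> < \<epsilon> / 8\<close> \<open>\<epsilon> > 0\<close> by (simp add: C_def \<eta>_def)
    then show ?thesis using infdist_lessE[OF \<open>B \<noteq> {}\<close>, of x "\<epsilon> / 2"] by (metis less_imp_le)
  qed
  have contF: "continuous_on UNIV F" by (rule lipschitz_on_continuous_on[OF F(2)])
  have C_bounded: "bounded C"
    unfolding bounded_iff
  proof (intro exI ballI)
    fix x assume "x \<in> C"
    then obtain b where "b \<in> B" "dist x b \<le> \<epsilon> / 2" using C_near by blast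
    then show "norm x \<le> R + \<epsilon> / 2" using R(2)[of b] norm_triangle_sub[of x b] by (simp add: dist_norm)
  qed
  have x0_int: "x0 \<in> interior C"
    using F_B[OF x0] by (intro interiorI[of "{x. F x < \<eta>}"] open_Collect_less contF continuous_on_const) (auto simp: C_def)
  have "convex_body C"
    unfolding convex_body_def
  proof (intro conjI C_bounded)
    show "closed C" unfolding C_def by (intro closed_Collect_le contF continuous_on_const)
    show "interior C \<noteq> {}" using x0_int by blast
    show "convex C"
      unfolding convex_alt
    proof (intro ballI allI impI)
      fix x y and u :: real assume xy: "x \<in> C" "y \<in> C" and u: "0 \<le> u \<and> u \<le> 1"
      have "F ((1 - u) *\<^sub>R x + u *\<^sub>R y) \<le> (1 - u) * F x + u * F y" using convex_onD[OF F(1), of u x y] u by simp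
      also have "\<dots> \<le> (1 - u) * \<eta> + u * \<eta>" using xy u by (intro add_mono mult_left_mono) (auto simp: C_def)
      finally show "(1 - u) *\<^sub>R x + u *\<^sub>R y \<in> C" by (simp add: C_def algebra_simps)
    qed
  qed
  moreover
  define G where "G y = F (x0 + y)" for y
  have shift: "(\<lambda>x. x - x0) ` C = {y. G y \<le> \<eta>}"
  proof (intro set_eqI iffI)
    fix y assume "y \<in> {y. G y \<le> \<eta>}"
    then have "x0 + y \<in> C" by (simp add: G_def C_def)
    then show "y \<in> (\<lambda>x. x - x0) ` C" by (rule rev_image_eqI) simp
  qed (auto simp: G_def C_def)
  interpret convex_sublevel G M \<eta> "(\<lambda>x. x - x0) ` C"
  proof
    show "convex_on UNIV G"
    proof
      fix t :: real and x y :: 'a assume t: "0 < t" "t < 1"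
      have "x0 + ((1 - t) *\<^sub>R x + t *\<^sub>R y) = (1 - t) *\<^sub>R (x0 + x) + t *\<^sub>R (x0 + y)" by (simp add: algebra_simps)
      then show "G ((1 - t) *\<^sub>R x + t *\<^sub>R y) \<le> (1 - t) * G x + t * G y"
        using convex_onD[OF F(1), of t "x0 + x" "x0 + y"] t by (simp add: G_def)
    qed simp
    show "M-lipschitz_on UNIV G"
    proof (rule lipschitz_onI)
      show "dist (G x) (G y) \<le> M * dist x y" for x y
        using lipschitz_onD[OF F(2), of "x0 + x" "x0 + y"] by (simp add: G_def)
      show "0 \<le> M" by (rule lipschitz_on_nonneg[OF F(2)])
    qed
    show "G 0 < \<eta>" using F_B[OF x0] by (simp add: G_def)
    show "(\<lambda>x. x - x0) ` C = {x. G x \<le> \<eta>}" by (rule shift)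
    show "bounded ((\<lambda>x. x - x0) ` C)" using bounded_translation_minus[OF C_bounded] .
  qed
  have G_diff: "G differentiable (at x)" for x
  proof -
    have "(F \<circ> (\<lambda>y. x0 + y)) differentiable (at x)" by (intro differentiable_chain_at F(3)) auto
    then show ?thesis by (simp add: G_def[abs_def] o_def)
  qed
  have "luc_function G"
    unfolding luc_function_def
  proof (intro allI impI)
    fix x :: 'a and xs :: "nat \<Rightarrow> 'a"
    assume lim: "(\<lambda>n. G x + G (xs n) - 2 * G ((1/2) *\<^sub>R (x + xs n))) \<longlonglongrightarrow> 0"
    have "x0 + (1/2) *\<^sub>R (x + y) = (1/2) *\<^sub>R ((x0 + x) + (x0 + y))" for y
      by (simp add: scaleR_add_right) (simp add: algebra_simps flip: scaleR_left_distrib)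
    with lim have "(\<lambda>n. F (x0 + x) + F (x0 + xs n) - 2 * F ((1/2) *\<^sub>R ((x0 + x) + (x0 + xs n)))) \<longlonglongrightarrow> 0"
      by (simp only: G_def)
    then have "(\<lambda>n. x0 + xs n) \<longlonglongrightarrow> x0 + x" using F(4) unfolding luc_function_def by simp
    from tendsto_diff[OF this tendsto_const[of x0]] show "xs \<longlonglongrightarrow> x" by simp
  qed
  then have "locally_uniformly_convex_body C"
    unfolding locally_uniformly_convex_body_def using x0_int locally_uniformly_convex by blast
  moreover have "frechet_smooth_body C"
    unfolding frechet_smooth_body_def using x0_int frechet_smooth[OF G_diff] by blast
  moreover have "hausdorff_dist B C \<le> \<epsilon> / 2"
  proof (rule hausdorff_dist_le)
    show "\<exists>c\<in>C. dist b c \<le> \<epsilon> / 2" if "b \<in> B" for b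
      using F_B[OF that] \<open>\<epsilon> > 0\<close> by (intro bexI[of _ b]) (auto simp: C_def)
  qed (use C_near \<open>\<epsilon> > 0\<close> in auto)
  then have "hausdorff_dist B C < \<epsilon>" using \<open>\<epsilon> > 0\<close> by simp
  ultimately show ?thesis by blast
qed

section \<open>From a smooth body to the Asplund property\<close>

lemma asplund_if_frechet_smooth_body:
  fixes C :: "'a::banach set"
  assumes "convex_body C" "frechet_smooth_body C"
  shows "asplund_space TYPE('a)"
proof -
  obtain x0 where x0: "x0 \<in> interior C" and smooth: "frechet_smooth_origin ((\<lambda>x. x - x0) ` C)"
    using assms(2) by (auto simp: frechet_smooth_body_def)
  define K where "K = (\<lambda>x. x - x0) ` C"
  define p where "p = minkowski_functional K"
  have "bounded K" unfolding K_def using assms(1) by (intro bounded_translation_minus) (simp add: convex_body_def)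
  then obtain R where R: "R > 0" "\<And>y. y \<in> K \<Longrightarrow> norm y \<le> R" by (auto simp: bounded_pos)
  obtain r where r: "r > 0" "cball x0 r \<subseteq> C" using x0 by (auto simp: mem_interior_cball)
  have K_cball: "y \<in> K" if "norm y \<le> r" for y
  proof -
    have "x0 + y \<in> C" using r(2) that by (auto simp: dist_norm)
    then show ?thesis unfolding K_def by (rule rev_image_eqI) simp
  qed
  \<comment> \<open>The ball of radius \<open>r\<close> inside \<open>K\<close> bounds the gauge
    above. Strict inequality makes \<open>t\<close> positive even for \<open>x = 0\<close>; the
    limit case follows by density.\<close>
  have p_le: "p x \<le> t" if t: "t > norm x / r" for x t
  proof -
    have "0 \<le> norm x / r" using r by simp
    then have "t > 0" using t by linarith
    moreover have "norm ((1 / t) *\<^sub>R x) \<le> r" using t r \<open>t > 0\<close> by (simp add: field_simps)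
    ultimately show ?thesis unfolding p_def by (intro minkowski_functional_le K_cball)
  qed
  have p_upper: "p x \<le> norm x / r" for x by (rule dense_ge) (rule p_le)
  have p_lower: "norm x / R \<le> p x" for x
    unfolding p_def
  proof (rule minkowski_functional_ge)
    \<comment> \<open>A scalar known to be admissible; the summand 1 keeps it positive at
      \<open>x = 0\<close>.\<close>
    show "norm x / r + 1 > 0" using r by (simp add: add_nonneg_pos)
    then show "(1 / (norm x / r + 1)) *\<^sub>R x \<in> K" using r by (intro K_cball) (simp add: field_simps)
    show "norm x / R \<le> s" if "s > 0" "(1 / s) *\<^sub>R x \<in> K" for s
      using R(2)[OF that(2)] that(1) R(1) by (simp add: field_simps)
  qed
  show ?thesis
  proof (rule asplund_if_smooth_gauge)
    show "p differentiable (at x)" if "x \<noteq> 0" for x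
      using smooth that by (simp add: frechet_smooth_origin_def p_def K_def)
    show "R > 0" "1 / r > 0" using R r by auto
    show "norm x \<le> R * p x" for x using p_lower[of x] R(1) by (simp add: field_simps)
    have "0 \<le> p x" for x using p_lower[of x] R(1) order_trans[OF divide_nonneg_pos] by (metis norm_ge_zero)
    then show "\<bar>p x\<bar> \<le> 1 / r * norm x" for x using p_upper[of x] by simp
  qed
qed

theorem theorem1p4:
  assumes separable: "separable_space (euclidean :: 'a::banach topology)"
  shows "(\<forall>B :: 'a set. convex_body B \<longrightarrow>
            (\<forall>\<epsilon>>0. \<exists>C :: 'a set. convex_body C \<and> locally_uniformly_convex_body C
                \<and> frechet_smooth_body C \<and> hausdorff_dist B C < \<epsilon>))
         \<longleftrightarrow> asplund_space TYPE('a)"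
proof
  assume approx: "\<forall>B :: 'a set. convex_body B \<longrightarrow>
            (\<forall>\<epsilon>>0. \<exists>C :: 'a set. convex_body C \<and> locally_uniformly_convex_body C
                \<and> frechet_smooth_body C \<and> hausdorff_dist B C < \<epsilon>)"
  have "convex_body (cball (0 :: 'a) 1)"
    using interior_mono[OF ball_subset_cball[of "0 :: 'a" 1]] centre_in_ball[of "0 :: 'a" 1]
    by (auto simp: convex_body_def)
  with approx obtain C :: "'a set" where "convex_body C" "frechet_smooth_body C"
    using zero_less_one by blast
  then show "asplund_space TYPE('a)" by (rule asplund_if_frechet_smooth_body)
next
  assume "asplund_space TYPE('a)"
  moreover obtain D :: "'a set" where "countable D" "closure D = UNIV"
    using separable by (auto simp: separable_space_def)
  ultimately show "\<forall>B :: 'a set. convex_body B \<longrightarrow>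
            (\<forall>\<epsilon>>0. \<exists>C :: 'a set. convex_body C \<and> locally_uniformly_convex_body C
                \<and> frechet_smooth_body C \<and> hausdorff_dist B C < \<epsilon>)"
    using asplund_approximation by blast
qed

end
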